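(* Let $(x_k)_{k\in\mathbb{Z}}$ be the stationary iterates of the stochastic Nesterov accelerated gradient method (SNAG) with stepsize $\gamma>0$ and momentum $\alpha\in[0,1)$ under the zero-th order noise model, with sampling with replacement (defined in the context). If $\left(\frac{1-\alpha}{1+\alpha}\right)^2\ge\gamma\lambda_i$ for all $i\in\{1,\dots,d\}$, then $$\mathrm{Tr}[\mathrm{Var}(x_k)]=\gamma^2\sum_{i=1}^d(u_i^\top\Sigma u_i)\frac{\sqrt{\rho_+^i}-\sqrt{\rho_-^i}-\frac1{\sqrt{\rho_+^i}}+\frac1{\sqrt{\rho_-^i}}}{4(1-\alpha(1-\gamma\lambda_i))\sqrt{(1-\gamma\lambda_i)((1-\alpha)^2-\gamma\lambda_i(1+\alpha)^2)}},$$ where $$\rho_\pm^i=\frac{1+(1+\alpha)^2(1-\gamma\lambda_i)^2+\alpha^2(1-\gamma\lambda_i)^2-6\alpha(1-\gamma\lambda_i)\pm2(1-\alpha(1-\gamma\lambda_i))\sqrt{(1-\gamma\lambda_i)((1-\alpha)^2-\gamma\lambda_i(1+\alpha)^2)}}{\gamma^2\lambda_i^2}.$$ In the limit $\gamma\lambda_i\ll1-\alpha$ for all $i\in\{1,\dots,d\}$, one obtains the same variance as in the corresponding limit for stochastic gradient descent with momentum (SGDM): $$\mathrm{Tr}[\mathrm{Var}(x_k)]=\sum_{i=1}^d\left(\frac{\gamma\,(u_i^\top\Sigma u_i)}{2(1-\alpha)\lambda_i}+O\left(\sqrt{\frac{\gamma^3}{\lambda_i}}\right)\right).$$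
   Context: Let $A_1,\dots,A_n\in\mathbb{R}^{d\times d}$ be symmetric and $b_1,\dots,b_n\in\mathbb{R}^d$; put $A=\frac1n\sum_i A_i$, assumed strictly positive definite, $b=\frac1n\sum_i b_i$, $x^\star=-A^{-1}b$, $y_i=-A_iA^{-1}b+b_i$ (so $\sum_i y_i=0$), $\Sigma=\frac1n\sum_{i=1}^n y_iy_i^\top$. Let $(u_i)_{i=1}^d$ be an orthonormal basis of eigenvectors of $A$, $Au_i=\lambda_iu_i$, $\lambda_i>0$. Zero-th order noise model: the gradient of $f_i(x)=\frac12x^\top A_ix+b_i^\top x$ is replaced by $\widehat{\nabla f_i}(x)=Ax+y_i+b$. SNAG: $x_{k+1}=w_k-\gamma\widehat{\nabla f_{i_k}}(w_k)$ with $w_k=x_k+\alpha(x_k-x_{k-1})$; equivalently, with $\Delta x_k=x_k-x^\star$, $\Delta x_{k+1}=(1+\alpha)(\mathrm{Id}-\gamma A)\Delta x_k-\alpha(\mathrm{Id}-\gamma A)\Delta x_{k-1}-\gamma y_{i_k}$. (SGDM is instead $x_{k+1}=x_k+\alpha(x_k-x_{k-1})-\gamma\widehat{\nabla f_{i_k}}(x_k)$.) Sampling with replacement: $(i_k)_{k\in\mathbb{Z}}$ i.i.d. uniform on $\{1,\dots,n\}$. Stationary iterates: $(\Delta x_k)_k$ is the output of the linear time-invariant system with input $(y_{i_k})_k$ defined by the SNAG recursion, i.e. $\Delta x_k=\sum_{j\in\mathbb{Z}}H_{k-j}y_{i_j}$, where $(H_k)_{k\in\mathbb{Z}}$ are the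 matrices with $\sum_kH_kz^{-k}=H(z):=-\gamma z(z^2\mathrm{Id}-z(1+\alpha)(\mathrm{Id}-\gamma A)+\alpha(\mathrm{Id}-\gamma A))^{-1}$ for $|z|=1$.
   Formalization: In the equality case γλ_i = ((1−α)/(1+α))² the displayed fraction is 0/0 and is read as its limit as λ_i is approached from below; the limit γλ_i ≪ 1−α is taken with α, n, d and the sampling sequence fixed, so the O-constant may depend on them (uniformity as α→1 fails). *)

theory Defs
  imports "HOL-Probability.Probability"
begin

section \<open>The quadratic finite-sum problem\<close>

text \<open>The components are indexed by a finite type \<open>'n\<close>, so \<open>n = CARD('n) \<ge> 1\<close>; the ambient
  space is \<open>real ^ 'd\<close>.\<close>

definition avg :: "('n::finite \<Rightarrow> 'v::real_vector) \<Rightarrow> 'v" where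
  "avg v = (1 / real CARD('n)) *\<^sub>R (\<Sum>i\<in>UNIV. v i)"

definition outer :: "real ^ 'd \<Rightarrow> real ^ 'd \<Rightarrow> real ^ 'd ^ 'd" where
  "outer v w = (\<chi> i j. v $ i * w $ j)"

definition symmetric_family :: "('n::finite \<Rightarrow> real ^ 'd ^ 'd) \<Rightarrow> bool" where
  "symmetric_family A \<longleftrightarrow> (\<forall>i. transpose (A i) = A i)"

definition strictly_posdef :: "real ^ 'd ^ 'd \<Rightarrow> bool" where
  "strictly_posdef B \<longleftrightarrow> (\<forall>v. v \<noteq> 0 \<longrightarrow> v \<bullet> (B *v v) > 0)"

definition orthonormal_eigenbasis :: 
    "real ^ 'd ^ 'd \<Rightarrow> ('d::finite \<Rightarrow> real ^ 'd) \<Rightarrow> ('d \<Rightarrow> real) \<Rightarrow> bool" where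
  "orthonormal_eigenbasis B u lam \<longleftrightarrow>
     (\<forall>i j. u i \<bullet> u j = (if i = j then 1 else 0)) \<and> (\<forall>i. B *v u i = lam i *\<^sub>R u i)"

definition minimizer :: 
    "('n::finite \<Rightarrow> real ^ 'd ^ 'd) \<Rightarrow> ('n \<Rightarrow> real ^ 'd) \<Rightarrow> real ^ 'd" where
  "minimizer A b = - (matrix_inv (avg A) *v avg b)"

text \<open>In the zero-th order noise model the gradient of the \<open>i\<close>-th component at \<open>x\<close> is replaced by
  \<open>avg A *v x + noise A b i + avg b\<close>.\<close>

definition noise :: 
    "('n::finite \<Rightarrow> real ^ 'd ^ 'd) \<Rightarrow> ('n \<Rightarrow> real ^ 'd) \<Rightarrow> 'n \<Rightarrow> real ^ 'd" where
  "noise A b i = - (A i *v (matrix_inv (avg A) *v avg b)) + b i"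

definition noise_cov :: 
    "('n::finite \<Rightarrow> real ^ 'd ^ 'd) \<Rightarrow> ('n \<Rightarrow> real ^ 'd) \<Rightarrow> real ^ 'd ^ 'd" where
  "noise_cov A b = avg (\<lambda>i. outer (noise A b i) (noise A b i))"


section \<open>Sampling with replacement and variance\<close>

definition iid_uniform :: "'w measure \<Rightarrow> (int \<Rightarrow> 'w \<Rightarrow> 'n::finite) \<Rightarrow> bool" where
  "iid_uniform M idx \<longleftrightarrow>
     prob_space.indep_vars M (\<lambda>_. count_space UNIV) idx UNIV \<and>
     (\<forall>k. distr M (count_space UNIV) (idx k) = uniform_count_measure UNIV)"

definition variance_matrix :: "'w measure \<Rightarrow> ('w \<Rightarrow> real ^ 'd) \<Rightarrow> real ^ 'd ^ 'd" where
  "variance_matrix M X =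
     (let m = (LINT \<omega>|M. X \<omega>) in LINT \<omega>|M. outer (X \<omega> - m) (X \<omega> - m))"


section \<open>Stationary iterates\<close>

text \<open>Transfer functions from the noise to \<open>x\<^sub>k - x\<^sup>*\<close>: the z-transforms of
  \<open>\<Delta>\<^sub>k\<^sub>+\<^sub>1 = (1 + \<alpha>) (Id - \<gamma> A) \<Delta>\<^sub>k - \<alpha> (Id - \<gamma> A) \<Delta>\<^sub>k\<^sub>-\<^sub>1 - \<gamma> y\<^sub>k\<close> (Nesterov) and
  \<open>\<Delta>\<^sub>k\<^sub>+\<^sub>1 = \<Delta>\<^sub>k + \<alpha> (\<Delta>\<^sub>k - \<Delta>\<^sub>k\<^sub>-\<^sub>1) - \<gamma> A \<Delta>\<^sub>k - \<gamma> y\<^sub>k\<close> (heavy ball). Here \<open>mat c\<close> is \<open>c\<close> times the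
  identity matrix.\<close>

definition cmat :: "real ^ 'd ^ 'd \<Rightarrow> complex ^ 'd ^ 'd" where
  "cmat = map_matrix complex_of_real"

definition snag_transfer :: 
    "real \<Rightarrow> real \<Rightarrow> real ^ 'd ^ 'd \<Rightarrow> complex \<Rightarrow> complex ^ 'd ^ 'd" where
  "snag_transfer \<gamma> \<alpha> B z =
     mat (- of_real \<gamma> * z) **
     matrix_inv (mat (z\<^sup>2) - mat (z * of_real (1 + \<alpha>)) ** cmat (mat 1 - \<gamma> *\<^sub>R B)
                 + mat (of_real \<alpha>) ** cmat (mat 1 - \<gamma> *\<^sub>R B))"

definition sgdm_transfer :: 
    "real \<Rightarrow> real \<Rightarrow> real ^ 'd ^ 'd \<Rightarrow> complex \<Rightarrow> complex ^ 'd ^ 'd" where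
  "sgdm_transfer \<gamma> \<alpha> B z =
     mat (- of_real \<gamma> * z) **
     matrix_inv (mat (z\<^sup>2) - mat z ** cmat (mat (1 + \<alpha>) - \<gamma> *\<^sub>R B) + mat (of_real \<alpha>))"

text \<open>The two-sided sequence of real matrices whose z-transform, on the unit circle, is the given
  transfer function.\<close>

definition impulse_response :: 
    "(complex \<Rightarrow> complex ^ 'd ^ 'd) \<Rightarrow> int \<Rightarrow> real ^ 'd ^ 'd" where
  "impulse_response T =
     (THE H. \<forall>z. cmod z = 1 \<longrightarrow>
        ((\<lambda>k::int. mat (z powi (- k)) ** cmat (H k)) has_sum T z) UNIV)"

definition stationary_iterate :: 
    "(complex \<Rightarrow> complex ^ 'd ^ 'd) \<Rightarrow> ('n::finite \<Rightarrow> real ^ 'd ^ 'd) \<Rightarrow> ('n \<Rightarrow> real ^ 'd) \<Rightarrow>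
     (int \<Rightarrow> 'w \<Rightarrow> 'n) \<Rightarrow> int \<Rightarrow> 'w \<Rightarrow> real ^ 'd" where
  "stationary_iterate T A b idx k \<omega> =
     minimizer A b + (\<Sum>\<^sub>\<infinity>j\<in>UNIV. impulse_response T (k - j) *v noise A b (idx j \<omega>))"

definition snag_iterate :: 
    "real \<Rightarrow> real \<Rightarrow> ('n::finite \<Rightarrow> real ^ 'd ^ 'd) \<Rightarrow> ('n \<Rightarrow> real ^ 'd) \<Rightarrow>
     (int \<Rightarrow> 'w \<Rightarrow> 'n) \<Rightarrow> int \<Rightarrow> 'w \<Rightarrow> real ^ 'd" where
  "snag_iterate \<gamma> \<alpha> A b = stationary_iterate (snag_transfer \<gamma> \<alpha> (avg A)) A b"

definition sgdm_iterate :: 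
    "real \<Rightarrow> real \<Rightarrow> ('n::finite \<Rightarrow> real ^ 'd ^ 'd) \<Rightarrow> ('n \<Rightarrow> real ^ 'd) \<Rightarrow>
     (int \<Rightarrow> 'w \<Rightarrow> 'n) \<Rightarrow> int \<Rightarrow> 'w \<Rightarrow> real ^ 'd" where
  "sgdm_iterate \<gamma> \<alpha> A b = stationary_iterate (sgdm_transfer \<gamma> \<alpha> (avg A)) A b"


section \<open>The variance coefficient of an eigendirection\<close>

definition snag_disc :: "real \<Rightarrow> real \<Rightarrow> real \<Rightarrow> real" where
  "snag_disc \<gamma> \<alpha> l = (1 - \<gamma> * l) * ((1 - \<alpha>)\<^sup>2 - \<gamma> * l * (1 + \<alpha>)\<^sup>2)"

definition rho_plus :: "real \<Rightarrow> real \<Rightarrow> real \<Rightarrow> real" where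
  "rho_plus \<gamma> \<alpha> l =
     (1 + (1 + \<alpha>)\<^sup>2 * (1 - \<gamma> * l)\<^sup>2 + \<alpha>\<^sup>2 * (1 - \<gamma> * l)\<^sup>2 - 6 * \<alpha> * (1 - \<gamma> * l)
      + 2 * (1 - \<alpha> * (1 - \<gamma> * l)) * sqrt (snag_disc \<gamma> \<alpha> l)) / (\<gamma>\<^sup>2 * l\<^sup>2)"

definition rho_minus :: "real \<Rightarrow> real \<Rightarrow> real \<Rightarrow> real" where
  "rho_minus \<gamma> \<alpha> l =
     (1 + (1 + \<alpha>)\<^sup>2 * (1 - \<gamma> * l)\<^sup>2 + \<alpha>\<^sup>2 * (1 - \<gamma> * l)\<^sup>2 - 6 * \<alpha> * (1 - \<gamma> * l)
      - 2 * (1 - \<alpha> * (1 - \<gamma> * l)) * sqrt (snag_disc \<gamma> \<alpha> l)) / (\<gamma>\<^sup>2 * l\<^sup>2)"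

definition snag_quotient :: "real \<Rightarrow> real \<Rightarrow> real \<Rightarrow> real" where
  "snag_quotient \<gamma> \<alpha> l =
     (sqrt (rho_plus \<gamma> \<alpha> l) - sqrt (rho_minus \<gamma> \<alpha> l)
      - 1 / sqrt (rho_plus \<gamma> \<alpha> l) + 1 / sqrt (rho_minus \<gamma> \<alpha> l)) /
     (4 * (1 - \<alpha> * (1 - \<gamma> * l)) * sqrt (snag_disc \<gamma> \<alpha> l))"

text \<open>On the boundary \<open>\<gamma> l = ((1 - \<alpha>) / (1 + \<alpha>))\<^sup>2\<close> of the admissible range the quotient has the
  form 0/0 (which HOL evaluates to 0). There it is read as its limit from inside the range, that
  is, as \<open>l\<close> is approached from below.\<close>

definition snag_coeff :: "real \<Rightarrow> real \<Rightarrow> real \<Rightarrow> real" where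
  "snag_coeff \<gamma> \<alpha> l =
     (if \<gamma> * l = ((1 - \<alpha>) / (1 + \<alpha>))\<^sup>2 then Lim (at_left l) (snag_quotient \<gamma> \<alpha>)
      else snag_quotient \<gamma> \<alpha> l)"

end

theory Submission
  imports Defs
begin

text \<open>In the eigenbasis of \<open>avg A\<close> the iteration splits into scalar second-order recursions whose
  characteristic roots are, for such step sizes, real and lie in \<open>[0, 1)\<close>. The impulse response
  along \<open>u\<^sub>i\<close> is \<open>-\<gamma> h\<^sub>n\<close>, where \<open>h\<close> is the convolution of two geometric sequences; it is
  determined by the transfer function
  because an absolutely convergent series vanishing on the unit circle has zero coefficients. Since
  the samples are independent and the noise is centred, the variance along \<open>u\<^sub>i\<close> is
  \<open>\<gamma>\<^sup>2 (u\<^sub>i \<bullet> \<Sigma> u\<^sub>i)\<close> times the sum of \<open>h\<^sub>n\<^sup>2\<close>, a rational function of \<open>\<alpha>\<close> and \<open>\<gamma> \<lambda>\<^sub>i\<close>.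
  The closed form with \<open>\<rho>\<^sub>\<plusminus>\<close> simplifies to it because \<open>\<rho>\<^sub>\<plusminus>\<close> are perfect squares.\<close>

section \<open>Series on the unit circle\<close>

lemma has_sum_sum:
  fixes f :: "'i \<Rightarrow> 'a \<Rightarrow> 'b :: topological_comm_monoid_add"
  assumes "\<And>i. i \<in> I \<Longrightarrow> (f i has_sum s i) A"
  shows "((\<lambda>x. \<Sum>i\<in>I. f i x) has_sum (\<Sum>i\<in>I. s i)) A"
  using assms by (induction I rule: infinite_finite_induct) (auto intro!: has_sum_add)

text \<open>Averaging \<open>z\<^sup>m\<close> times the series over the \<open>N\<close>-th roots of unity keeps only the
  coefficients with index congruent to \<open>m\<close> modulo \<open>N\<close>; let \<open>N\<close> tend to infinity.\<close>

lemma circle_series_coeff_zero: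
  fixes c :: "int \<Rightarrow> complex"
  assumes "\<And>z. cmod z = 1 \<Longrightarrow> ((\<lambda>k. z powi (- k) * c k) has_sum 0) UNIV"
  shows "c m = 0"
proof -
  define w where "w N = cis (2 * pi / real (Suc N))" for N
  define a where "a N k = (\<Sum>j<Suc N. (w N ^ j) powi (m - k)) / of_nat (Suc N)" for N k
  have w1: "cmod (w N ^ j) = 1" "w N \<noteq> 0" for N j
    by (simp_all add: w_def norm_power)
  \<comment> \<open>At \<open>z = 1\<close> the hypothesis makes \<open>c\<close> itself summable,
    and unordered summability of complex numbers is absolute.\<close>
  have abs: "(\<lambda>k. norm (c k)) summable_on UNIV"
    using assms[of 1] summable_on_iff_abs_summable_on_complex[of c UNIV]
    by (auto dest: has_sum_imp_summable)
  have zero: "((\<lambda>k. a N k * c k) has_sum 0) UNIV" for N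
  proof -
    have *: "((\<lambda>k. (w N ^ j) powi (m - k) * c k) has_sum 0) UNIV" for j
      using has_sum_cmult_right[OF assms[OF w1(1)[of N j]], of "(w N ^ j) powi m"] w1(2)[of N]
      by (simp add: power_int_diff power_int_minus field_simps)
    have "((\<lambda>k. (\<Sum>j<Suc N. (w N ^ j) powi (m - k) * c k)) has_sum (\<Sum>j<Suc N. 0)) UNIV"
      by (rule has_sum_sum) (rule *)
    from has_sum_cmult_right[OF this, of "1 / of_nat (Suc N)"] show ?thesis
      by (simp add: a_def sum_distrib_right del: sum.lessThan_Suc of_nat_Suc)
  qed
  have bound: "cmod (a N k) \<le> 1" for N k
  proof -
    have "cmod (\<Sum>j<Suc N. (w N ^ j) powi (m - k)) \<le> (\<Sum>j<Suc N. 1)"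
      by (rule sum_norm_le) (simp add: norm_power_int w1(1))
    then show ?thesis
      by (simp add: a_def norm_divide divide_simps del: sum.lessThan_Suc of_nat_Suc)
  qed
  have diag: "a N m = 1" for N
    by (simp add: a_def del: sum.lessThan_Suc of_nat_Suc)
  have off: "a N k = 0" if "k \<noteq> m" "nat \<bar>m - k\<bar> \<le> N" for N k
  proof -
    define q where "q = w N powi (m - k)"
    have q: "q = cis (2 * pi * (of_int (m - k) / real (Suc N)))"
      by (simp add: q_def w_def cis_power_int mult_ac)
    have "real (Suc N) * (2 * pi * (of_int (m - k) / real (Suc N))) = 2 * pi * of_int (m - k)"
      by (simp del: of_nat_Suc)
    then have "q ^ Suc N = cis (2 * pi * of_int (m - k))"
      unfolding q Complex.DeMoivre by (rule arg_cong)
    then have qN: "q ^ Suc N = 1"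
      by (simp add: cis_multiple_2pi del: power_Suc)
    \<comment> \<open>Otherwise \<open>Suc N\<close> would divide the nonzero integer
      \<open>m - k\<close>, whose absolute value is at most \<open>N\<close>.\<close>
    have "q \<noteq> 1"
    proof
      assume "q = 1"
      then have "cos (2 * pi * (of_int (m - k) / real (Suc N))) = 1"
        by (simp add: q complex_eq_iff)
      then obtain n :: int where "2 * pi * (of_int (m - k) / real (Suc N)) = of_int n * 2 * pi"
        by (auto simp: cos_one_2pi_int)
      then have "2 * pi * (of_int (m - k) / real (Suc N)) = 2 * pi * of_int n"
        by (simp only: mult_ac)
      then have "of_int (m - k) / real (Suc N) = of_int n"
        by (subst (asm) mult_left_cancel) auto
      then have "real_of_int (m - k) = of_int (n * int (Suc N))"
        by (simp add: field_simps)
      then have eq: "m - k = n * int (Suc N)" by (simp only: of_int_eq_iff)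
      with that(1) have "n \<noteq> 0" by auto
      then have "int (Suc N) \<le> \<bar>n * int (Suc N)\<bar>" by (simp add: abs_mult del: of_nat_Suc)
      then show False using that(2) eq by linarith
    qed
    moreover have "(w N ^ j) powi (m - k) = q ^ j" for j
      by (simp add: q_def power_int_power power_int_power' mult.commute)
    moreover have "(\<Sum>j<Suc N. q ^ j) = (1 - q ^ Suc N) / (1 - q)"
      using \<open>q \<noteq> 1\<close> by (simp add: sum_gp_strict del: sum.lessThan_Suc power_Suc)
    ultimately show ?thesis by (simp add: a_def qN del: sum.lessThan_Suc power_Suc)
  qed
  \<comment> \<open>Read as an integral for counting measure, the series admits dominated
    convergence with majorant \<open>norm (c k)\<close>; each weight \<open>a N k\<close> is
    eventually constant in \<open>N\<close>.\<close>
  let ?M = "count_space (UNIV :: int set)"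
  have int: "integrable ?M (\<lambda>k. norm (c k))"
    using abs abs_summable_equivalent[of c UNIV] by (simp add: abs_summable_on_def integrable_norm)
  have "(\<lambda>N. \<integral>k. a N k * c k \<partial>?M) \<longlonglongrightarrow> (\<integral>k. (if k = m then c m else 0) \<partial>?M)"
  proof (rule integral_dominated_convergence[where w = "\<lambda>k. norm (c k)"])
    show "AE k in ?M. (\<lambda>N. a N k * c k) \<longlonglongrightarrow> (if k = m then c m else 0)"
    proof (rule AE_I2)
      fix k
      show "(\<lambda>N. a N k * c k) \<longlonglongrightarrow> (if k = m then c m else 0)"
        by (cases "k = m")
          (auto simp: diag intro!: tendsto_eventually eventually_sequentiallyI[of "nat \<bar>m - k\<bar>"] off)
    qed
    show "AE k in ?M. norm (a N k * c k) \<le> norm (c k)" for N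
      using bound by (auto simp: norm_mult mult_left_le_one_le)
  qed (use int in auto)
  moreover have "(\<integral>k. a N k * c k \<partial>?M) = 0" for N
  proof -
    have "(\<lambda>k. norm (a N k * c k)) summable_on UNIV"
      using has_sum_imp_summable[OF zero[of N]] by (simp only: summable_on_iff_abs_summable_on_complex)
    from infsetsum_infsum[OF this[unfolded abs_summable_equivalent]] show ?thesis
      using infsumI[OF zero[of N]] by (simp add: infsetsum_def)
  qed
  moreover have "(\<integral>k. (if k = m then c m else 0) \<partial>?M) = c m"
    using lebesgue_integral_count_space_finite_support[of UNIV "\<lambda>k. if k = m then c m else 0"]
    by simp
  ultimately show ?thesis
    using LIMSEQ_unique[of "\<lambda>_. 0 :: complex"] by fastforce
qed

text \<open>Turns a one-sided series into an unordered sum over a larger index set. It serves both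
  the lags \<open>n + 1\<close> and the sampling times \<open>k - 1 - n\<close>.\<close>

lemma has_sum_range_nat:
  fixes f :: "'a \<Rightarrow> 'b :: banach" and e :: "nat \<Rightarrow> 'a"
  assumes "inj e" "\<And>j. j \<notin> range e \<Longrightarrow> f j = 0" "summable (\<lambda>n. norm (f (e n)))"
  shows "(f has_sum (\<Sum>n. f (e n))) UNIV"
proof -
  have "((f \<circ> e) has_sum (\<Sum>n. f (e n))) UNIV"
    using assms(3) unfolding o_def
    by (intro norm_summable_imp_has_sum summable_sums) (auto intro: summable_norm_cancel)
  then have "(f has_sum (\<Sum>n. f (e n))) (range e)"
    using assms(1) by (simp add: has_sum_reindex)
  then show ?thesis
    by (subst has_sum_cong_neutral[where T = "range e" and g = f]) (use assms(2) in auto)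
qed

lemma has_sum_vecI:
  fixes f :: "'a \<Rightarrow> 'b :: topological_comm_monoid_add ^ 'd"
  assumes "\<And>i. ((\<lambda>k. f k $ i) has_sum (s $ i)) A"
  shows "(f has_sum s) A"
  unfolding has_sum_def by (rule vec_tendstoI) (use assms in \<open>simp add: has_sum_def\<close>)

lemma mat_mult_nth: "(mat c ** X) $ a $ b = c * X $ a $ b"
  for X :: "'a :: semiring_1 ^ 'm ^ 'd"
  by (simp add: matrix_matrix_mult_def mat_def if_distrib[where f = "\<lambda>y. y * _"] cong: if_cong)

text \<open>Resolves the definite description: the entries of the difference of two candidates are
  coefficients of a series vanishing on the unit circle, hence zero. Exhibiting one sequence
  therefore suffices.\<close>

lemma impulse_response_eqI:
  assumes H: "\<And>z. cmod z = 1 \<Longrightarrow>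
    ((\<lambda>k::int. mat (z powi (- k)) ** cmat (H k)) has_sum T z) UNIV"
  shows "impulse_response T = H"
  unfolding impulse_response_def
proof (rule the_equality)
  fix H' assume H': "\<forall>z. cmod z = 1 \<longrightarrow>
    ((\<lambda>k::int. mat (z powi (- k)) ** cmat (H' k)) has_sum T z) UNIV"
  have nth: "((\<lambda>k. f k $ a $ b) has_sum (s $ a $ b)) UNIV"
    if "(f has_sum s) UNIV" for f :: "int \<Rightarrow> complex ^ 'a ^ 'a" and s a b
    by (intro has_sum_bounded_linear[where h = "\<lambda>x. x $ b", OF bounded_linear_vec_nth]
        has_sum_bounded_linear[where h = "\<lambda>x. x $ a", OF bounded_linear_vec_nth] that)
  have "H' m $ a $ b - H m $ a $ b = 0" for m a b
  proof -
    have "complex_of_real (H' m $ a $ b - H m $ a $ b) = 0"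
    proof (rule circle_series_coeff_zero[where c = "\<lambda>k. complex_of_real (H' k $ a $ b - H k $ a $ b)"])
      fix z assume z: "cmod z = 1"
      from H' z nth[of _ _ a b]
      have 1: "((\<lambda>k. z powi - k * of_real (H' k $ a $ b)) has_sum (T z $ a $ b)) UNIV"
        by (fastforce simp: mat_mult_nth cmat_def)
      from H[OF z] nth[of _ _ a b]
      have 2: "((\<lambda>k. z powi - k * of_real (H k $ a $ b)) has_sum (T z $ a $ b)) UNIV"
        by (fastforce simp: mat_mult_nth cmat_def)
      from has_sum_add[OF 1 has_sum_uminusI[OF 2]]
      show "((\<lambda>k. z powi - k * complex_of_real (H' k $ a $ b - H k $ a $ b)) has_sum 0) UNIV"
        by (simp add: algebra_simps)
    qed
    then show ?thesis by (simp only: of_real_eq_0_iff)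
  qed
  then show "H' = H" by (simp add: fun_eq_iff vec_eq_iff)
qed (use H in blast)

section \<open>Functions of the averaged matrix\<close>

text \<open>For square matrices over a field a right inverse is two-sided, and uniqueness of
  inverses then pins down the choice made by \<open>matrix_inv\<close>.\<close>

lemma matrix_inv_eqI:
  fixes P Q :: "'a :: field ^ 'd ^ 'd"
  assumes "P ** Q = mat 1"
  shows "matrix_inv P = Q"
proof -
  have QP: "Q ** P = mat 1" using assms by (simp add: matrix_left_right_inverse)
  have "P ** matrix_inv P = mat 1 \<and> matrix_inv P ** P = mat 1"
    unfolding matrix_inv_def by (rule someI[where x = Q]) (simp add: assms QP)
  then show ?thesis
    by (metis QP matrix_mul_assoc matrix_mul_lid matrix_mul_rid)
qed

text \<open>For orthonormal \<open>u\<close> this is the functional calculus: the matrix with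
  eigenvalue \<open>f i\<close> on \<open>u i\<close>. The values are complex because transfer
  functions are evaluated at complex \<open>z\<close>.\<close>

definition spectral_matrix :: "('d::finite \<Rightarrow> real ^ 'd) \<Rightarrow> ('d \<Rightarrow> complex) \<Rightarrow> complex ^ 'd ^ 'd" where
  "spectral_matrix u f = (\<chi> a b. \<Sum>i\<in>UNIV. f i * of_real (u i $ a * u i $ b))"

lemma spectral_matrix_add: "spectral_matrix u f + spectral_matrix u g = spectral_matrix u (\<lambda>i. f i + g i)"
  by (simp add: spectral_matrix_def vec_eq_iff sum.distrib algebra_simps)

lemma spectral_matrix_diff: "spectral_matrix u f - spectral_matrix u g = spectral_matrix u (\<lambda>i. f i - g i)"
  by (simp add: spectral_matrix_def vec_eq_iff sum_subtractf algebra_simps)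

text \<open>With the \<open>u i\<close> as columns of \<open>U\<close>, orthonormality is
  \<open>transpose U ** U = mat 1\<close>; for a square matrix the factors may be exchanged, and the
  entries of the new product are these sums.\<close>

lemma eigenbasis_complete:
  assumes "orthonormal_eigenbasis B u lam"
  shows "(\<Sum>i\<in>UNIV. u i $ a * u i $ b) = (if a = b then 1 else 0)"
proof -
  define U :: "real ^ 'a ^ 'a" where "U = (\<chi> a i. u i $ a)"
  have "transpose U ** U = mat 1"
    using assms by (simp add: orthonormal_eigenbasis_def vec_eq_iff matrix_matrix_mult_def U_def
        transpose_def mat_def inner_vec_def)
  then have "U ** transpose U = mat 1" by (simp add: matrix_left_right_inverse)
  then have "(U ** transpose U) $ a $ b = mat 1 $ a $ b" by simp
  then show ?thesis
    by (simp add: matrix_matrix_mult_def U_def transpose_def mat_def)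
qed

lemma spectral_matrix_const:
  assumes "orthonormal_eigenbasis B u lam"
  shows "mat c = spectral_matrix u (\<lambda>_. c)"
proof -
  have "(\<Sum>i\<in>UNIV. c * of_real (u i $ a * u i $ b)) = (if a = b then c else 0)" for a b
    using arg_cong[OF eigenbasis_complete[OF assms, of a b], of "\<lambda>x. c * complex_of_real x"]
    by (simp add: sum_distrib_left)
  then show ?thesis by (simp add: spectral_matrix_def vec_eq_iff mat_def)
qed

text \<open>The eigenvalue equation rewrites \<open>lam i * u i $ a\<close> as a row of
  \<open>B\<close> applied to \<open>u i\<close>; completeness then collapses the sum over the
  eigenvectors.\<close>

lemma cmat_spectral:
  assumes "orthonormal_eigenbasis B u lam"
  shows "cmat B = spectral_matrix u (\<lambda>i. of_real (lam i))"
proof -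
  have "(\<Sum>i\<in>UNIV. lam i * (u i $ a * u i $ b)) = B $ a $ b" for a b
  proof -
    have "lam i * u i $ a = (\<Sum>c\<in>UNIV. B $ a $ c * u i $ c)" for i
    proof -
      have "B *v u i = lam i *\<^sub>R u i" using assms by (simp add: orthonormal_eigenbasis_def)
      then have "(B *v u i) $ a = (lam i *\<^sub>R u i) $ a" by simp
      then show ?thesis by (simp add: matrix_vector_mult_def)
    qed
    then have "(\<Sum>i\<in>UNIV. lam i * (u i $ a * u i $ b)) =
        (\<Sum>i\<in>UNIV. \<Sum>c\<in>UNIV. B $ a $ c * (u i $ c * u i $ b))"
      by (simp add: sum_distrib_right flip: mult.assoc)
    also have "\<dots> = (\<Sum>c\<in>UNIV. B $ a $ c * (\<Sum>i\<in>UNIV. u i $ c * u i $ b))"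
      by (subst sum.swap) (simp add: sum_distrib_left)
    finally show ?thesis
      by (simp add: eigenbasis_complete[OF assms] if_distrib[where f = "\<lambda>y. _ * y"] cong: if_cong)
  qed
  from arg_cong[OF this, of complex_of_real] show ?thesis
    by (simp add: cmat_def spectral_matrix_def vec_eq_iff)
qed

text \<open>Orthonormality removes the cross terms, so products, and with them inverses, can be
  taken eigenvalue by eigenvalue.\<close>

lemma spectral_matrix_mult:
  assumes "orthonormal_eigenbasis B u lam"
  shows "spectral_matrix u f ** spectral_matrix u g = spectral_matrix u (\<lambda>i. f i * g i)"
proof -
  have orth: "(\<Sum>c\<in>UNIV. u i $ c * u j $ c) = (if i = j then 1 else 0)" for i j
    using assms by (simp add: orthonormal_eigenbasis_def inner_vec_def)
  have "(\<Sum>c\<in>UNIV. (\<Sum>i\<in>UNIV. f i * of_real (u i $ a * u i $ c)) *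
      (\<Sum>j\<in>UNIV. g j * of_real (u j $ c * u j $ b))) =
      (\<Sum>i\<in>UNIV. f i * g i * of_real (u i $ a * u i $ b))" for a b
  proof -
    have "(\<Sum>c\<in>UNIV. (\<Sum>i\<in>UNIV. f i * of_real (u i $ a * u i $ c)) *
        (\<Sum>j\<in>UNIV. g j * of_real (u j $ c * u j $ b))) =
        (\<Sum>c\<in>UNIV. \<Sum>i\<in>UNIV. \<Sum>j\<in>UNIV. f i * g j * of_real (u i $ a * u j $ b) *
          of_real (u i $ c * u j $ c))"
      by (simp add: sum_product mult_ac)
    also have "\<dots> = (\<Sum>i\<in>UNIV. \<Sum>j\<in>UNIV. \<Sum>c\<in>UNIV. f i * g j * of_real (u i $ a * u j $ b) *
          of_real (u i $ c * u j $ c))"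
      by (subst sum.swap, rule sum.cong[OF refl], rule sum.swap)
    also have "\<dots> = (\<Sum>i\<in>UNIV. \<Sum>j\<in>UNIV. f i * g j * of_real (u i $ a * u j $ b) *
          of_real (\<Sum>c\<in>UNIV. u i $ c * u j $ c))"
      by (simp add: sum_distrib_left)
    also have "\<dots> = (\<Sum>i\<in>UNIV. f i * g i * of_real (u i $ a * u i $ b))"
      by (simp add: orth if_distrib[where f = of_real] if_distrib[where f = "\<lambda>y. _ * y"] cong: if_cong)
    finally show ?thesis .
  qed
  then show ?thesis by (simp add: spectral_matrix_def vec_eq_iff matrix_matrix_mult_def)
qed

lemma matrix_inv_spectral:
  assumes "orthonormal_eigenbasis B u lam" and "\<And>i. f i \<noteq> 0"
  shows "matrix_inv (spectral_matrix u f) = spectral_matrix u (\<lambda>i. 1 / f i)"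
  using assms(2) by (intro matrix_inv_eqI)
    (simp add: spectral_matrix_mult[OF assms(1)] spectral_matrix_const[OF assms(1)])

section \<open>Transfer functions in the eigenbasis\<close>

lemma cmat_affine_spectral:
  assumes "orthonormal_eigenbasis B u lam"
  shows "cmat (mat c - \<gamma> *\<^sub>R B) = spectral_matrix u (\<lambda>i. of_real (c - \<gamma> * lam i))"
proof -
  have "cmat (mat c - \<gamma> *\<^sub>R B) = mat (of_real c) - mat (of_real \<gamma>) ** cmat B"
    by (simp add: cmat_def vec_eq_iff mat_def matrix_matrix_mult_def
        if_distrib[where f = "\<lambda>y. y * _"] cong: if_cong)
  then show ?thesis
    by (simp add: cmat_spectral[OF assms] spectral_matrix_const[OF assms] spectral_matrix_mult[OF assms] spectral_matrix_diff)
qed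

text \<open>The matrix to be inverted is a polynomial in \<open>B\<close>, so on \<open>u i\<close>
  it acts as a scalar quadratic in \<open>z\<close>; since none of these vanishes, the inverse is a
  genuine one.\<close>

lemma snag_transfer_spectral:
  assumes B: "orthonormal_eigenbasis B u lam"
    and "\<And>i. z\<^sup>2 - z * of_real ((1 + \<alpha>) * (1 - \<gamma> * lam i)) + of_real (\<alpha> * (1 - \<gamma> * lam i)) \<noteq> 0"
  shows "snag_transfer \<gamma> \<alpha> B z = spectral_matrix u (\<lambda>i. - of_real \<gamma> *
    (z / (z\<^sup>2 - z * of_real ((1 + \<alpha>) * (1 - \<gamma> * lam i)) + of_real (\<alpha> * (1 - \<gamma> * lam i)))))"
proof -
  have "mat (z\<^sup>2) - mat (z * of_real (1 + \<alpha>)) ** cmat (mat 1 - \<gamma> *\<^sub>R B)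
      + mat (of_real \<alpha>) ** cmat (mat 1 - \<gamma> *\<^sub>R B) =
    spectral_matrix u (\<lambda>i. z\<^sup>2 - z * of_real ((1 + \<alpha>) * (1 - \<gamma> * lam i)) + of_real (\<alpha> * (1 - \<gamma> * lam i)))"
    by (simp add: cmat_affine_spectral[OF B] spectral_matrix_const[OF B] spectral_matrix_mult[OF B]
        spectral_matrix_diff spectral_matrix_add mult.assoc)
  then show ?thesis
    unfolding snag_transfer_def
    by (simp only: matrix_inv_spectral[OF B assms(2)] spectral_matrix_mult[OF B]
        spectral_matrix_const[OF B, of "- of_real \<gamma> * z"])
      (simp add: mult_ac)
qed

lemma sgdm_transfer_spectral:
  assumes B: "orthonormal_eigenbasis B u lam"
    and "\<And>i. z\<^sup>2 - z * of_real (1 + \<alpha> - \<gamma> * lam i) + of_real \<alpha> \<noteq> 0"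
  shows "sgdm_transfer \<gamma> \<alpha> B z = spectral_matrix u (\<lambda>i. - of_real \<gamma> *
    (z / (z\<^sup>2 - z * of_real (1 + \<alpha> - \<gamma> * lam i) + of_real \<alpha>)))"
proof -
  have "mat (z\<^sup>2) - mat z ** cmat (mat (1 + \<alpha>) - \<gamma> *\<^sub>R B) + mat (of_real \<alpha>) =
    spectral_matrix u (\<lambda>i. z\<^sup>2 - z * of_real (1 + \<alpha> - \<gamma> * lam i) + of_real \<alpha>)"
    by (simp add: cmat_affine_spectral[OF B] spectral_matrix_const[OF B] spectral_matrix_mult[OF B]
        spectral_matrix_diff spectral_matrix_add mult.assoc)
  then show ?thesis
    unfolding sgdm_transfer_def
    by (simp only: matrix_inv_spectral[OF B assms(2)] spectral_matrix_mult[OF B]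
        spectral_matrix_const[OF B, of "- of_real \<gamma> * z"])
      (simp add: mult_ac)
qed

section \<open>Positive definiteness, and the mean and covariance of the noise\<close>

lemma eigenvalue_pos:
  assumes "orthonormal_eigenbasis B u lam" "strictly_posdef B"
  shows "lam i > 0"
proof -
  have *: "u i \<bullet> u i = 1" "B *v u i = lam i *\<^sub>R u i"
    using assms(1) by (simp_all add: orthonormal_eigenbasis_def)
  then have "u i \<noteq> 0" by auto
  with assms(2) have "u i \<bullet> (B *v u i) > 0" by (simp add: strictly_posdef_def)
  then show ?thesis by (simp add: *)
qed

lemma matrix_inv_posdef:
  assumes "strictly_posdef (B :: real ^ 'd ^ 'd)"
  shows "B ** matrix_inv B = mat 1"
proof -
  have "\<forall>x. B *v x = 0 \<longrightarrow> x = 0"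
    using assms by (force simp: strictly_posdef_def)
  then obtain C where "C ** B = mat 1"
    using matrix_left_invertible_ker[of B] by blast
  then have "B ** C = mat 1" by (simp add: matrix_left_right_inverse)
  then show ?thesis using matrix_inv_eqI by metis
qed

lemma matrix_vector_mult_sum_left:
  "(\<Sum>i\<in>I. A i) *v x = (\<Sum>i\<in>I. A i *v x)" for A :: "'i \<Rightarrow> real ^ 'd ^ 'd"
  by (induction I rule: infinite_finite_induct) (auto simp: matrix_vector_mult_add_rdistrib)

text \<open>Averaging replaces \<open>A i\<close> by \<open>avg A\<close>, which cancels against its
  inverse. This is the centring that makes distinct samples uncorrelated later.\<close>

lemma avg_noise:
  assumes "strictly_posdef (avg A)"
  shows "avg (noise A b) = 0"
proof -
  have "avg (\<lambda>i. - (A i *v x) + b i) = - (avg A *v x) + avg b" for x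
    by (simp add: avg_def sum.distrib sum_negf sum_subtractf matrix_vector_mult_sum_left
        scaleR_matrix_vector_assoc[symmetric] scaleR_diff_right)
  then have "avg (noise A b) = - (avg A *v (matrix_inv (avg A) *v avg b)) + avg b"
    by (simp only: noise_def[abs_def])
  also have "\<dots> = 0"
    by (simp add: matrix_vector_mul_assoc matrix_inv_posdef[OF assms])
  finally show ?thesis .
qed

lemma outer_mult_vec: "outer v w *v x = (w \<bullet> x) *\<^sub>R v"
  by (simp add: vec_eq_iff outer_def matrix_vector_mult_def inner_vec_def sum_distrib_left mult_ac)

text \<open>Connects \<Sigma> to scalar series: along \<open>v\<close> the covariance is the mean
  square of the projected noise, which is also visibly nonnegative.\<close>

lemma inner_noise_cov:
  "v \<bullet> (noise_cov A b *v v) = (\<Sum>i\<in>UNIV. (v \<bullet> noise A b i)\<^sup>2) / real CARD('n)"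
  for A :: "'n::finite \<Rightarrow> real ^ 'd ^ 'd"
  by (simp add: noise_cov_def avg_def scaleR_matrix_vector_assoc[symmetric] outer_mult_vec
      matrix_vector_mult_sum_left inner_sum_right power2_eq_square inner_commute)

section \<open>The scalar second-order recursion\<close>

text \<open>Index \<open>n\<close> corresponds to time lag \<open>n + 1\<close> in the impulse response.\<close>

definition ar_kernel :: "real \<Rightarrow> real \<Rightarrow> nat \<Rightarrow> real" where
  "ar_kernel p q n = (\<Sum>i\<le>n. p ^ i * q ^ (n - i))"

lemma ar_kernel_0 [simp]: "ar_kernel p q 0 = 1"
  by (simp add: ar_kernel_def)

lemma ar_kernel_Suc: "ar_kernel p q (Suc n) = q * ar_kernel p q n + p ^ Suc n"
  by (simp add: ar_kernel_def sum_distrib_left Suc_diff_le mult_ac)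

text \<open>Identifies \<open>p\<close> and \<open>q\<close> as the characteristic roots. The
  convolution form includes the double root \<open>p = q\<close>, so no case distinction
  arises.\<close>

lemma ar_kernel_Suc_Suc:
  "ar_kernel p q (Suc (Suc n)) = (p + q) * ar_kernel p q (Suc n) - p * q * ar_kernel p q n"
  by (simp add: ar_kernel_Suc algebra_simps)

text \<open>All terms are nonnegative, and the kernel is the Cauchy product of two convergent
  geometric series.\<close>

lemma summable_ar_kernel:
  assumes "0 \<le> p" "p < 1" "0 \<le> q" "q < 1"
  shows "summable (\<lambda>n. \<bar>ar_kernel p q n\<bar>)"
proof -
  have "\<bar>ar_kernel p q n\<bar> = (\<Sum>i\<le>n. p ^ i * q ^ (n - i))" for n
    using assms by (auto simp: ar_kernel_def intro!: abs_of_nonneg sum_nonneg)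
  moreover have "summable (\<lambda>n. \<Sum>i\<le>n. p ^ i * q ^ (n - i))"
    using assms by (intro summable_Cauchy_product) (auto simp: norm_power intro!: summable_geometric)
  ultimately show ?thesis by simp
qed

text \<open>The Cauchy product of the geometric series in \<open>p / z\<close> and
  \<open>q / z\<close>. The additional factor \<open>1 / z\<close> shifts index \<open>n\<close> to
  lag \<open>n + 1\<close>, and the quadratic factors as \<open>(z - p) (z - q)\<close>.\<close>

lemma ar_kernel_sums:
  fixes z :: complex
  assumes "0 \<le> p" "p < 1" "0 \<le> q" "q < 1" "cmod z = 1"
  shows "(\<lambda>n. of_real (ar_kernel p q n) * z powi (- (int n + 1))) sums
    (z / (z\<^sup>2 - z * of_real (p + q) + of_real (p * q)))"
proof -
  have [simp]: "z \<noteq> 0" using assms(5) by auto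
  have geo: "summable (\<lambda>k. norm ((of_real r / z) ^ k))"
      "(\<Sum>k. (of_real r / z) ^ k) = 1 / (1 - of_real r / z)"
      "z - of_real r \<noteq> 0" if "0 \<le> r" "r < 1" for r
  proof -
    have r: "norm (of_real r / z) < 1" using that assms(5) by (simp add: norm_divide)
    then show "summable (\<lambda>k. norm ((of_real r / z) ^ k))"
      by (auto simp: norm_power intro!: summable_geometric)
    show "(\<Sum>k. (of_real r / z) ^ k) = 1 / (1 - of_real r / z)"
      by (rule suminf_geometric[OF r])
    show "z - of_real r \<noteq> 0" using that assms(5) by auto
  qed
  have "(\<lambda>n. \<Sum>i\<le>n. (of_real p / z) ^ i * (of_real q / z) ^ (n - i)) sums
      (1 / (1 - of_real p / z) * (1 / (1 - of_real q / z)))"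
    using Cauchy_product_sums[OF geo(1) geo(1), of p q] assms by (simp add: geo(2))
  from sums_mult[OF this, of "1 / z"]
  have "(\<lambda>n. 1 / z * (\<Sum>i\<le>n. (of_real p / z) ^ i * (of_real q / z) ^ (n - i))) sums
      (1 / z * (1 / (1 - of_real p / z) * (1 / (1 - of_real q / z))))" .
  moreover have "1 / z * (\<Sum>i\<le>n. (of_real p / z) ^ i * (of_real q / z) ^ (n - i)) =
      of_real (ar_kernel p q n) * z powi (- (int n + 1))" for n
  proof -
    have "(of_real p / z) ^ i * (of_real q / z) ^ (n - i) = of_real (p ^ i * q ^ (n - i)) / z ^ n"
      if "i \<le> n" for i
      using that by (simp add: power_divide flip: power_add)
    then have sum: "(\<Sum>i\<le>n. (of_real p / z) ^ i * (of_real q / z) ^ (n - i)) = of_real (ar_kernel p q n) / z ^ n"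
      by (simp add: ar_kernel_def sum_divide_distrib)
    have "z powi (- int (Suc n)) = 1 / (z * z ^ n)"
      by (simp add: power_int_minus divide_inverse del: of_nat_Suc)
    then show ?thesis
      unfolding sum by (simp add: add.commute)
  qed
  moreover have "1 / z * (1 / (1 - of_real p / z) * (1 / (1 - of_real q / z))) =
      z / (z\<^sup>2 - z * of_real (p + q) + of_real (p * q))"
  proof -
    have "z\<^sup>2 - z * of_real (p + q) + of_real (p * q) = (z - of_real p) * (z - of_real q)"
      by (simp add: power2_eq_square algebra_simps)
    moreover have "1 - of_real r / z = (z - of_real r) / z" for r
      by (simp add: field_simps)
    ultimately show ?thesis using geo(3)[of p] geo(3)[of q] assms
      by (simp add: divide_simps)
  qed
  ultimately show ?thesis by simp
qed

text \<open>Squaring the recursion, or multiplying it by \<open>h\<^sub>n\<^sub>+\<^sub>1\<close>, and summing over \<open>n\<close> gives two linear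
  equations for the sums of \<open>h\<^sub>n\<^sup>2\<close> and of \<open>h\<^sub>n h\<^sub>n\<^sub>+\<^sub>1\<close>.\<close>

lemma suminf_ar_kernel_square:
  assumes "0 \<le> p" "p < 1" "0 \<le> q" "q < 1"
  shows "summable (\<lambda>n. (ar_kernel p q n)\<^sup>2)"
    and "(\<Sum>n. (ar_kernel p q n)\<^sup>2) =
      (1 + p * q) / ((1 - p * q) * ((1 + p * q)\<^sup>2 - (p + q)\<^sup>2))"
proof -
  let ?h = "ar_kernel p q" and ?a = "p + q" and ?c = "p * q"
  have sh: "summable (\<lambda>n. \<bar>?h n\<bar>)" by (rule summable_ar_kernel[OF assms])
  \<comment> \<open>A null sequence is bounded, so every product \<open>h n * h (f n)\<close> is
    dominated by a multiple of the summable \<open>\<bar>h n\<bar>\<close>.\<close>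
  then have "?h \<longlonglongrightarrow> 0"
    by (auto intro: summable_LIMSEQ_zero summable_rabs_cancel)
  then obtain K where K: "\<bar>?h n\<bar> \<le> K" for n
    by (metis Bseq_def convergent_def convergent_imp_Bseq real_norm_def)
  have prod: "summable (\<lambda>n. ?h n * ?h (f n))" for f
  proof (rule summable_comparison_test')
    show "summable (\<lambda>n. K * \<bar>?h n\<bar>)" using sh by (rule summable_mult)
    show "norm (?h n * ?h (f n)) \<le> K * \<bar>?h n\<bar>" for n
      using mult_right_mono[OF K[of "f n"], of "\<bar>?h n\<bar>"] by (simp add: abs_mult mult.commute)
  qed
  show s2: "summable (\<lambda>n. (?h n)\<^sup>2)"
    using prod[of "\<lambda>n. n"] by (simp add: power2_eq_square)
  define S0 S1 where "S0 = (\<Sum>n. (?h n)\<^sup>2)" and "S1 = (\<Sum>n. ?h n * ?h (Suc n))"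
  have s0: "(\<lambda>n. (?h n)\<^sup>2) sums S0" and s1: "(\<lambda>n. ?h n * ?h (Suc n)) sums S1"
    using s2 prod by (auto simp: S0_def S1_def summable_sums)
  \<comment> \<open>Shifting the index removes the initial terms, which come from
    \<open>h 0 = 1\<close> and \<open>h 1 = p + q\<close>.\<close>
  have s0': "(\<lambda>n. (?h (Suc n))\<^sup>2) sums (S0 - 1)"
    using s0 by (subst sums_Suc_iff) simp
  have h1: "?h (Suc 0) = ?a" by (simp add: ar_kernel_Suc)
  have s1': "(\<lambda>n. ?h (Suc n) * ?h (Suc (Suc n))) sums (S1 - ?a)"
    using s1 by (subst sums_Suc_iff[where f = "\<lambda>n. ?h n * ?h (Suc n)"]) (simp add: h1)
  have s0'': "(\<lambda>n. (?h (Suc (Suc n)))\<^sup>2) sums (S0 - 1 - ?a\<^sup>2)"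
    using s0' by (subst sums_Suc_iff[where f = "\<lambda>n. (?h (Suc n))\<^sup>2"]) (simp add: h1)
  have "(\<lambda>n. ?a * (?h (Suc n))\<^sup>2 - ?c * (?h n * ?h (Suc n))) sums (?a * (S0 - 1) - ?c * S1)"
    by (intro sums_diff sums_mult s0' s1)
  moreover have "?a * (?h (Suc n))\<^sup>2 - ?c * (?h n * ?h (Suc n)) = ?h (Suc n) * ?h (Suc (Suc n))" for n
    unfolding ar_kernel_Suc_Suc by (simp add: power2_eq_square algebra_simps)
  ultimately have e1: "S1 - ?a = ?a * (S0 - 1) - ?c * S1"
    using s1' by (simp add: sums_unique2)
  have "(\<lambda>n. ?a\<^sup>2 * (?h (Suc n))\<^sup>2 - 2 * ?a * ?c * (?h n * ?h (Suc n)) + ?c\<^sup>2 * (?h n)\<^sup>2) sums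
      (?a\<^sup>2 * (S0 - 1) - 2 * ?a * ?c * S1 + ?c\<^sup>2 * S0)"
    by (intro sums_diff sums_add sums_mult s0' s1 s0)
  moreover have "?a\<^sup>2 * (?h (Suc n))\<^sup>2 - 2 * ?a * ?c * (?h n * ?h (Suc n)) + ?c\<^sup>2 * (?h n)\<^sup>2 =
      (?h (Suc (Suc n)))\<^sup>2" for n
    unfolding ar_kernel_Suc_Suc by (simp add: power2_eq_square algebra_simps)
  ultimately have e2: "S0 - 1 - ?a\<^sup>2 = ?a\<^sup>2 * (S0 - 1) - 2 * ?a * ?c * S1 + ?c\<^sup>2 * S0"
    using s0'' by (simp add: sums_unique2)
  have c: "0 \<le> ?c" "?c < 1"
    using assms by (auto intro: mult_nonneg_nonneg) (metis mult.right_neutral mult_strict_mono' order.strict_trans1 zero_le_one assms mult_left_le less_eq_real_def)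
  \<comment> \<open>A product of the values of the characteristic polynomial at \<open>1\<close> and
    at \<open>-1\<close>, both positive for roots in \<open>[0, 1)\<close>.\<close>
  have pq: "(1 + ?c)\<^sup>2 - ?a\<^sup>2 = (1 - p) * (1 - q) * ((1 + p) * (1 + q))"
    by (simp add: power2_eq_square algebra_simps)
  have pos: "(1 + ?c)\<^sup>2 - ?a\<^sup>2 > 0"
    unfolding pq using assms by auto
  \<comment> \<open>Eliminate \<open>S1\<close> through \<open>e1\<close>, then clear the
    denominator \<open>1 + p * q\<close> in \<open>e2\<close>; a linear equation for
    \<open>S0\<close> remains.\<close>
  have "(1 + ?c) * S1 = ?a * S0" using e1 by (simp add: algebra_simps)
  then have "S1 = ?a * S0 / (1 + ?c)" using c by (simp add: field_simps)
  with e2 have "S0 * (1 - ?a\<^sup>2 - ?c\<^sup>2) + 2 * ?a * ?c * (?a * S0 / (1 + ?c)) = 1"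
    by (simp add: algebra_simps)
  then have "(1 + ?c) * (S0 * (1 - ?a\<^sup>2 - ?c\<^sup>2) + 2 * ?a * ?c * (?a * S0 / (1 + ?c))) = 1 + ?c"
    by simp
  moreover have "(1 + ?c) * (2 * ?a * ?c * (?a * S0 / (1 + ?c))) = 2 * ?a * ?c * (?a * S0)"
    using c by (simp add: field_simps)
  ultimately have "S0 * ((1 - ?c) * ((1 + ?c)\<^sup>2 - ?a\<^sup>2)) = 1 + ?c"
    by (simp add: distrib_left) (simp add: power2_eq_square algebra_simps)
  then show "(\<Sum>n. (?h n)\<^sup>2) = (1 + ?c) / ((1 - ?c) * ((1 + ?c)\<^sup>2 - ?a\<^sup>2))"
    using c pos unfolding S0_def[symmetric] by (subst eq_divide_eq) auto
qed

text \<open>The quadratic formula. The discriminant is nonnegative, \<open>0 \<le> c\<close> keeps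
  both roots nonnegative, and \<open>a < 1 + c\<close> together with \<open>a < 2\<close> puts the
  larger one below \<open>1\<close>.\<close>

lemma stable_real_roots:
  fixes a c :: real
  assumes "0 \<le> a" "0 \<le> c" "c < 1" "a < 1 + c" "4 * c \<le> a\<^sup>2"
  obtains p q where "0 \<le> p" "p < 1" "0 \<le> q" "q < 1" "p + q = a" "p * q = c"
proof -
  define d where "d = sqrt (a\<^sup>2 - 4 * c)"
  have d2: "d\<^sup>2 = a\<^sup>2 - 4 * c" "0 \<le> d" using assms by (auto simp: d_def)
  have "d\<^sup>2 \<le> a\<^sup>2" using d2 assms by auto
  then have da: "d \<le> a" using assms(1) by (rule power2_le_imp_le)
  have sum: "(a - d) / 2 + (a + d) / 2 = a" by (simp add: field_simps)
  have prod: "(a - d) / 2 * ((a + d) / 2) = c"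
    using d2(1) by (simp add: field_simps power2_eq_square)
  have a2: "a < 2" using assms by simp
  have "d < 2 - a"
  proof (rule power2_less_imp_less)
    have "a\<^sup>2 - 4 * c < a\<^sup>2 - 4 * (a - 1)" using assms by simp
    then show "d\<^sup>2 < (2 - a)\<^sup>2" unfolding d2 by (simp add: power2_eq_square algebra_simps)
  qed (use a2 in simp)
  then show thesis
    using da d2(2) assms(1) by (intro that[OF _ _ _ _ sum prod]) auto
qed

section \<open>Series of independent uniform samples\<close>

lemma summable_mult_finite_range:
  fixes f :: "'n::finite \<Rightarrow> real" and g :: "nat \<Rightarrow> real"
  assumes "summable (\<lambda>n. \<bar>g n\<bar>)"
  shows "summable (\<lambda>n. \<bar>g n * f (s n)\<bar>)"
proof (rule summable_comparison_test')
  show "summable (\<lambda>n. \<bar>g n\<bar> * Max (range (\<lambda>i. \<bar>f i\<bar>)))"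
    using assms by (rule summable_mult2)
  show "norm \<bar>g n * f (s n)\<bar> \<le> \<bar>g n\<bar> * Max (range (\<lambda>i. \<bar>f i\<bar>))" for n
    by (simp add: abs_mult mult_left_mono)
qed

text \<open>Dominated convergence along the partial sums, whose first two moments are finite sums.\<close>

lemma iid_series_moments:
  fixes idx :: "int \<Rightarrow> 'w \<Rightarrow> 'n::finite" and f :: "'n \<Rightarrow> real" and g :: "nat \<Rightarrow> real"
  assumes "prob_space M" and iid: "iid_uniform M idx" and f0: "(\<Sum>i\<in>UNIV. f i) = 0"
    and g: "summable (\<lambda>n. \<bar>g n\<bar>)" and e: "inj e"
  defines "W \<equiv> \<lambda>\<omega>. \<Sum>n. g n * f (idx (e n) \<omega>)"
  shows "W \<in> borel_measurable M" "integrable M W" "integrable M (\<lambda>\<omega>. (W \<omega>)\<^sup>2)"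
    and "(\<integral>\<omega>. W \<omega> \<partial>M) = 0"
    and "(\<integral>\<omega>. (W \<omega>)\<^sup>2 \<partial>M) = (\<Sum>n. (g n)\<^sup>2) * ((\<Sum>i\<in>UNIV. (f i)\<^sup>2) / real CARD('n))"
    and "\<exists>K. \<forall>\<omega>. \<bar>W \<omega>\<bar> \<le> K"
proof -
  interpret prob_space M by fact
  have indep: "indep_vars (\<lambda>_. count_space UNIV) idx UNIV"
    and distr: "\<And>k. distr M (count_space UNIV) (idx k) = uniform_count_measure UNIV"
    using iid by (auto simp: iid_uniform_def)
  have idx [measurable]: "idx k \<in> measurable M (count_space UNIV)" for k
    using indep by (auto simp: indep_vars_def)
  define F where "F = Max (range (\<lambda>i. \<bar>f i\<bar>))"
  have F: "\<bar>f i\<bar> \<le> F" for i unfolding F_def by (rule Max_ge) auto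
  have F0: "0 \<le> F" using F[of undefined] by linarith
  have mean: "(\<integral>\<omega>. h (idx k \<omega>) \<partial>M) = (\<Sum>i\<in>UNIV. h i) / real CARD('n)" for h :: "'n \<Rightarrow> real" and k
  proof -
    have "(\<integral>\<omega>. h (idx k \<omega>) \<partial>M) = (\<integral>i. h i \<partial>distr M (count_space UNIV) (idx k))"
      by (subst integral_distr) auto
    then show ?thesis by (simp add: distr integral_uniform_count_measure)
  qed
  have bnd: "integrable M (\<lambda>\<omega>. f (idx k \<omega>))" for k
    by (rule integrable_const_bound[where B = F]) (auto simp: F)
  \<comment> \<open>Independence factors the expectation, and each factor vanishes because
    \<open>f\<close> is centred.\<close>
  have pair: "(\<integral>\<omega>. f (idx j \<omega>) * f (idx k \<omega>) \<partial>M) = 0" if "j \<noteq> k" for j k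
  proof -
    have "indep_vars (\<lambda>_. borel) (\<lambda>i \<omega>. f (idx i \<omega>)) {j, k}"
      by (rule indep_vars_compose2[OF indep_vars_subset[OF indep]]) auto
    from indep_vars_lebesgue_integral[OF _ this] bnd that show ?thesis
      by (simp add: mean f0)
  qed
  define S where "S N \<omega> = (\<Sum>n<N. g n * f (idx (e n) \<omega>))" for N \<omega>
  have [measurable]: "S N \<in> borel_measurable M" for N
    unfolding S_def by measurable
  have lim: "(\<lambda>N. S N \<omega>) \<longlonglongrightarrow> W \<omega>" for \<omega>
  proof -
    have "summable (\<lambda>n. g n * f (idx (e n) \<omega>))"
      by (rule summable_rabs_cancel) (rule summable_mult_finite_range[OF g, of f])
    then show ?thesis unfolding S_def W_def by (rule summable_LIMSEQ)
  qed
  \<comment> \<open>A bound on all partial sums, uniform in \<omega>: on a probability space the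
    constants \<open>K\<close> and \<open>K^2\<close> are integrable majorants for the first and
    second moments.\<close>
  define K where "K = (\<Sum>n. \<bar>g n\<bar> * F)"
  have SK: "\<bar>S N \<omega>\<bar> \<le> K" for N \<omega>
  proof -
    have "\<bar>S N \<omega>\<bar> \<le> (\<Sum>n<N. \<bar>g n\<bar> * F)"
      unfolding S_def
      by (rule order_trans[OF sum_abs]) (simp add: abs_mult sum_mono mult_left_mono F)
    also have "\<dots> \<le> K" unfolding K_def by (rule sum_le_suminf) (simp_all add: F0 summable_mult2 g)
    finally show ?thesis .
  qed
  have WK: "\<bar>W \<omega>\<bar> \<le> K" for \<omega>
    by (rule LIMSEQ_le_const2[OF tendsto_rabs[OF lim]]) (use SK in auto)
  then show "\<exists>K. \<forall>\<omega>. \<bar>W \<omega>\<bar> \<le> K" by blast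
  show W [measurable]: "W \<in> borel_measurable M"
    by (rule borel_measurable_LIMSEQ_real[OF lim]) measurable
  show "integrable M W" by (rule integrable_const_bound[where B = K]) (auto simp: WK)
  have sq: "x\<^sup>2 \<le> K\<^sup>2" if "\<bar>x\<bar> \<le> K" for x
    using power_mono[OF that, of 2] by simp
  show "integrable M (\<lambda>\<omega>. (W \<omega>)\<^sup>2)"
    by (rule integrable_const_bound[where B = "K\<^sup>2"]) (auto intro: sq WK)
  have "(\<lambda>N. \<integral>\<omega>. S N \<omega> \<partial>M) \<longlonglongrightarrow> (\<integral>\<omega>. W \<omega> \<partial>M)"
    by (rule integral_dominated_convergence[where w = "\<lambda>_. K"]) (auto simp: SK lim)
  moreover have "(\<integral>\<omega>. S N \<omega> \<partial>M) = 0" for N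
    unfolding S_def by (subst Bochner_Integration.integral_sum) (auto simp: bnd mean f0)
  ultimately show "(\<integral>\<omega>. W \<omega> \<partial>M) = 0"
    using LIMSEQ_unique[of "\<lambda>_. 0 :: real"] by fastforce
  define v where "v = (\<Sum>i\<in>UNIV. (f i)\<^sup>2) / real CARD('n)"
  have int2: "integrable M (\<lambda>\<omega>. f (idx j \<omega>) * f (idx k \<omega>))" for j k
    by (rule integrable_const_bound[where B = "F * F"])
      (auto simp: abs_mult intro!: mult_mono F F0)
  have "(\<integral>\<omega>. (S N \<omega>)\<^sup>2 \<partial>M) = (\<Sum>n<N. (g n)\<^sup>2) * v" for N
  proof -
    have "(S N \<omega>)\<^sup>2 = (\<Sum>n<N. \<Sum>m<N. (g n * g m) * (f (idx (e n) \<omega>) * f (idx (e m) \<omega>)))" for \<omega>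
      by (simp add: S_def power2_eq_square sum_product mult_ac)
    then have "(\<integral>\<omega>. (S N \<omega>)\<^sup>2 \<partial>M) =
        (\<Sum>n<N. \<Sum>m<N. (g n * g m) * (\<integral>\<omega>. f (idx (e n) \<omega>) * f (idx (e m) \<omega>) \<partial>M))"
      by (simp add: Bochner_Integration.integral_sum int2)
    \<comment> \<open>Only the diagonal survives: injectivity of \<open>e\<close> turns
      \<open>n \<noteq> m\<close> into distinct sampling times.\<close>
    also have "\<dots> = (\<Sum>n<N. \<Sum>m<N. if n = m then (g n)\<^sup>2 * v else 0)"
    proof (intro sum.cong refl)
      fix n m
      show "(g n * g m) * (\<integral>\<omega>. f (idx (e n) \<omega>) * f (idx (e m) \<omega>) \<partial>M) =
          (if n = m then (g n)\<^sup>2 * v else 0)"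
      proof (cases "n = m")
        case True
        then show ?thesis
          using mean[of "\<lambda>i. (f i)\<^sup>2" "e n"] by (simp add: v_def power2_eq_square)
      next
        case False
        then show ?thesis using pair[of "e n" "e m"] e by (simp add: inj_eq)
      qed
    qed
    finally show ?thesis by (simp add: sum_distrib_right)
  qed
  moreover have "(\<lambda>N. \<integral>\<omega>. (S N \<omega>)\<^sup>2 \<partial>M) \<longlonglongrightarrow> (\<integral>\<omega>. (W \<omega>)\<^sup>2 \<partial>M)"
    by (rule integral_dominated_convergence[where w = "\<lambda>_. K\<^sup>2"])
      (auto intro!: sq SK tendsto_power lim)
  moreover have "(\<lambda>N. (\<Sum>n<N. (g n)\<^sup>2) * v) \<longlonglongrightarrow> (\<Sum>n. (g n)\<^sup>2) * v"
  proof (intro tendsto_mult_right summable_LIMSEQ)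
    have "eventually (\<lambda>n. \<bar>g n\<bar> < 1) sequentially"
      using order_tendstoD(2)[OF summable_LIMSEQ_zero[OF g], of 1] by simp
    moreover have "norm ((g n)\<^sup>2) \<le> \<bar>g n\<bar>" if "\<bar>g n\<bar> < 1" for n
      using mult_right_mono[of "\<bar>g n\<bar>" 1 "\<bar>g n\<bar>"] that by (simp add: power2_eq_square)
    ultimately show "summable (\<lambda>n. (g n)\<^sup>2)"
      by (intro summable_comparison_test_ev[OF _ g]) (auto elim!: eventually_mono)
  qed
  ultimately show "(\<integral>\<omega>. (W \<omega>)\<^sup>2 \<partial>M) = (\<Sum>n. (g n)\<^sup>2) * ((\<Sum>i\<in>UNIV. (f i)\<^sup>2) / real CARD('n))"
    by (auto simp flip: v_def intro: LIMSEQ_unique)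
qed

section \<open>The variance coefficients\<close>

text \<open>The sum of \<open>h n ^ 2\<close> in closed form,
  \<open>(1 + c) / ((1 - c) * ((1 + c)^2 - a^2))\<close>, for
  \<open>a = (1 + \<alpha>) (1 - t)\<close> and \<open>c = \<alpha> (1 - t)\<close>, where
  \<open>t\<close> stands for \<gamma> times an eigenvalue.\<close>

definition snag_gain :: "real \<Rightarrow> real \<Rightarrow> real" where
  "snag_gain \<alpha> t = (1 + \<alpha> * (1 - t)) / ((1 - \<alpha> * (1 - t)) * t * (2 - t + 2 * \<alpha> * (1 - t)))"

text \<open>With \<open>t = \<gamma> l\<close> and \<open>s = 1 - t\<close> the numerators of \<open>\<rho>\<^sub>\<plusminus>\<close> are the squares
  \<open>(1 - \<alpha> s \<plusminus> sqrt D)\<^sup>2\<close>, where \<open>D = snag_disc \<gamma> \<alpha> l\<close>.\<close>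

lemma snag_quotient_eq:
  assumes \<gamma>: "\<gamma> > 0" and l: "l > 0" and \<alpha>: "0 \<le> \<alpha>" "\<alpha> < 1"
    and t: "\<gamma> * l < ((1 - \<alpha>) / (1 + \<alpha>))\<^sup>2"
  shows "snag_quotient \<gamma> \<alpha> l = snag_gain \<alpha> (\<gamma> * l)"
proof -
  define t s where "t = \<gamma> * l" and "s = 1 - t"
  define D where "D = snag_disc \<gamma> \<alpha> l"
  define P where "P = 1 - \<alpha> * s"
  have t0: "t > 0" using \<gamma> l by (simp add: t_def)
  have tlt: "t * (1 + \<alpha>)\<^sup>2 < (1 - \<alpha>)\<^sup>2"
    using t \<alpha> by (simp add: t_def power_divide pos_less_divide_eq)
  moreover have "(1 - \<alpha>)\<^sup>2 \<le> (1 + \<alpha>)\<^sup>2" using \<alpha> by (intro power_mono) auto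
  ultimately have "t * (1 + \<alpha>)\<^sup>2 < 1 * (1 + \<alpha>)\<^sup>2" by simp
  then have "t < 1" by (rule mult_right_less_imp_less) simp
  then have s: "0 < s" "s < 1" using t0 by (auto simp: s_def)
  have Ddef: "D = s * ((1 - \<alpha>)\<^sup>2 - t * (1 + \<alpha>)\<^sup>2)"
    by (simp add: D_def snag_disc_def s_def t_def)
  have D: "D > 0" using s tlt by (simp add: Ddef)
  have "\<alpha> * s \<le> \<alpha> * 1" using s \<alpha> by (intro mult_left_mono) auto
  then have P: "P > 0" using \<alpha> by (simp add: P_def)
  have "2 - t + 2 * \<alpha> * s = 1 + s + 2 * (\<alpha> * s)" by (simp add: s_def)
  then have Q: "2 - t + 2 * \<alpha> * s > 0"
    using s \<alpha> mult_nonneg_nonneg[of \<alpha> s] by linarith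
  have PD: "P\<^sup>2 - D = t * (2 - t + 2 * \<alpha> * s)"
    by (simp add: P_def Ddef s_def power2_eq_square algebra_simps)
  define d where "d = sqrt D"
  have d: "d > 0" "d\<^sup>2 = D" using D by (auto simp: d_def)
  \<comment> \<open>Positivity of \<open>P - d\<close> fixes the sign when the square root in
    \<open>rho_minus\<close> is taken.\<close>
  have "d\<^sup>2 < P\<^sup>2" using PD t0 Q d(2) mult_pos_pos[OF t0 Q] by linarith
  then have dP: "d < P" using P by (simp add: power2_less_imp_less)
  have num: "1 + (1 + \<alpha>)\<^sup>2 * s\<^sup>2 + \<alpha>\<^sup>2 * s\<^sup>2 - 6 * \<alpha> * s = P\<^sup>2 + d\<^sup>2"
    unfolding d(2) by (simp add: P_def Ddef s_def power2_eq_square algebra_simps)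
  have "rho_plus \<gamma> \<alpha> l = (P\<^sup>2 + d\<^sup>2 + 2 * P * d) / t\<^sup>2"
    unfolding num[symmetric] by (simp add: rho_plus_def d_def D_def P_def s_def t_def power_mult_distrib)
  also have "\<dots> = ((P + d) / t)\<^sup>2"
    by (simp add: power_divide power2_eq_square algebra_simps)
  finally have rp: "sqrt (rho_plus \<gamma> \<alpha> l) = (P + d) / t"
    using P d t0 by simp
  have "rho_minus \<gamma> \<alpha> l = (P\<^sup>2 + d\<^sup>2 - 2 * P * d) / t\<^sup>2"
    unfolding num[symmetric] by (simp add: rho_minus_def d_def D_def P_def s_def t_def power_mult_distrib)
  also have "\<dots> = ((P - d) / t)\<^sup>2"
    by (simp add: power_divide power2_eq_square algebra_simps)
  finally have rm: "sqrt (rho_minus \<gamma> \<alpha> l) = (P - d) / t"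
    using dP t0 by simp
  have prod: "(P + d) * (P - d) = t * (2 - t + 2 * \<alpha> * s)"
    using PD d(2) by (simp add: power2_eq_square algebra_simps)
  \<comment> \<open>Both pairs of terms carry the factor \<open>(P + d) - (P - d) = 2 * d\<close>,
    which later cancels the root in the denominator; the product \<open>(P + d) * (P - d)\<close> is
    free of roots.\<close>
  have "sqrt (rho_plus \<gamma> \<alpha> l) - sqrt (rho_minus \<gamma> \<alpha> l)
      - 1 / sqrt (rho_plus \<gamma> \<alpha> l) + 1 / sqrt (rho_minus \<gamma> \<alpha> l) =
      2 * d / t + 2 * d * t / ((P + d) * (P - d))"
  proof -
    have "x / t - y / t - 1 / (x / t) + 1 / (y / t) = (x - y) / t + (x - y) * t / (x * y)"
      if "x > 0" "y > 0" for x y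
      using that t0 by (simp add: field_simps)
    from this[of "P + d" "P - d"] show ?thesis
      using d dP P unfolding rp rm by simp
  qed
  also have "\<dots> = 2 * d / t + 2 * d / (2 - t + 2 * \<alpha> * s)"
    unfolding prod using t0 by simp
  also have "\<dots> = 4 * d * (1 + \<alpha> * s) / (t * (2 - t + 2 * \<alpha> * s))"
    using t0 Q by (simp add: field_simps)
  finally have "snag_quotient \<gamma> \<alpha> l = 4 * d * (1 + \<alpha> * s) / (t * (2 - t + 2 * \<alpha> * s)) / (4 * P * d)"
    by (simp add: snag_quotient_def d_def D_def P_def s_def t_def)
  also have "\<dots> = (1 + \<alpha> * s) / (P * t * (2 - t + 2 * \<alpha> * s))"
  proof -
    have "4 * d * x / y / (4 * P * d) = x / (P * y)" for x y
      using d by simp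
    then show ?thesis by (simp only: mult.assoc)
  qed
  finally show ?thesis by (simp add: snag_gain_def P_def s_def t_def)
qed

text \<open>Makes both factors of \<open>snag_disc\<close> nonnegative. The second bound holds
  because \<open>(1 - \<alpha>) / (1 + \<alpha>)\<close> is at most \<open>1\<close>.\<close>

lemma admissible_step:
  fixes \<alpha> t :: real
  assumes "0 \<le> \<alpha>" "\<alpha> < 1" "t \<le> ((1 - \<alpha>) / (1 + \<alpha>))\<^sup>2"
  shows "t * (1 + \<alpha>)\<^sup>2 \<le> (1 - \<alpha>)\<^sup>2" "t \<le> 1"
proof -
  show *: "t * (1 + \<alpha>)\<^sup>2 \<le> (1 - \<alpha>)\<^sup>2"
    using assms by (simp add: power_divide pos_le_divide_eq)
  have "(1 - \<alpha>)\<^sup>2 \<le> (1 + \<alpha>)\<^sup>2" using assms by (intro power_mono) auto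
  with * have "t * (1 + \<alpha>)\<^sup>2 \<le> 1 * (1 + \<alpha>)\<^sup>2" by simp
  then show "t \<le> 1" by (rule mult_right_le_imp_le) (use assms in simp)
qed

text \<open>Lower bounds uniform in \<open>t\<close>, used for continuity of the gain and for its
  expansion near \<open>0\<close>.\<close>

lemma gain_denominators:
  fixes \<alpha> t :: real
  assumes "0 \<le> \<alpha>" "\<alpha> < 1" "0 < t" "t \<le> 1"
  shows "1 - \<alpha> * (1 - t) \<ge> 1 - \<alpha>" "2 - t + 2 * \<alpha> * (1 - t) \<ge> 1"
proof -
  have "\<alpha> * (1 - t) \<le> \<alpha> * 1" "0 \<le> \<alpha> * (1 - t)"
    using assms by (intro mult_left_mono mult_nonneg_nonneg; simp)+
  then show "1 - \<alpha> * (1 - t) \<ge> 1 - \<alpha>" "2 - t + 2 * \<alpha> * (1 - t) \<ge> 1"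
    using assms(4) by (simp_all add: mult.assoc)
qed

text \<open>Inside the range this is the simplification of the quotient. On the boundary the gain is
  still continuous, so it equals the left limit that defines the coefficient there.\<close>

lemma snag_coeff_eq:
  assumes \<gamma>: "\<gamma> > 0" and l: "l > 0" and \<alpha>: "0 \<le> \<alpha>" "\<alpha> < 1"
    and t: "\<gamma> * l \<le> ((1 - \<alpha>) / (1 + \<alpha>))\<^sup>2"
  shows "snag_coeff \<gamma> \<alpha> l = snag_gain \<alpha> (\<gamma> * l)"
proof (cases "\<gamma> * l = ((1 - \<alpha>) / (1 + \<alpha>))\<^sup>2")
  case True
  have pos: "\<gamma> * l > 0" using \<gamma> l by simp
  note den = gain_denominators[OF \<alpha> pos admissible_step(2)[OF \<alpha> t]]
  have "((\<lambda>x. snag_gain \<alpha> (\<gamma> * x)) \<longlongrightarrow> snag_gain \<alpha> (\<gamma> * l)) (at_left l)"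
    unfolding snag_gain_def
    by (intro tendsto_intros) (use den pos \<alpha> in auto)
  \<comment> \<open>Every \<open>x\<close> strictly between \<open>0\<close> and \<open>l\<close>
    satisfies the strict step condition.\<close>
  moreover have "eventually (\<lambda>x. snag_gain \<alpha> (\<gamma> * x) = snag_quotient \<gamma> \<alpha> x) (at_left l)"
    unfolding eventually_at_left_field
    using l \<gamma> \<alpha> True by (intro exI[of _ 0]) (auto intro!: snag_quotient_eq[symmetric] simp flip: True)
  ultimately have "(snag_quotient \<gamma> \<alpha> \<longlongrightarrow> snag_gain \<alpha> (\<gamma> * l)) (at_left l)"
    by (rule Lim_transform_eventually)
  then have "Lim (at_left l) (snag_quotient \<gamma> \<alpha>) = snag_gain \<alpha> (\<gamma> * l)"
    by (intro tendsto_Lim) simp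
  then show ?thesis using True by (simp add: snag_coeff_def)
next
  case False
  then show ?thesis using snag_quotient_eq[OF \<gamma> l \<alpha>] t by (simp add: snag_coeff_def)
qed

section \<open>Expansion of the gains for small steps\<close>

lemma le_sqrt_unit: "0 \<le> t \<Longrightarrow> t \<le> 1 \<Longrightarrow> t \<le> sqrt t"
  by (rule real_le_rsqrt) (simp add: power2_eq_square mult_left_le_one_le)

text \<open>Over a common denominator the numerator \<open>N\<close> has a factor \<open>t\<close>,
  so the error is of order \<open>t\<close>; it is weakened to \<open>sqrt t\<close> to match the
  rate in the theorem.\<close>

lemma snag_gain_near_0:
  assumes \<alpha>: "0 \<le> \<alpha>" "\<alpha> < 1" and t: "0 < t" "t \<le> 1"
  shows "\<bar>t * snag_gain \<alpha> t - 1 / (2 * (1 - \<alpha>))\<bar> \<le> 6 / (1 - \<alpha>)\<^sup>2 * sqrt t"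
proof -
  define P Q where "P = 1 - \<alpha> * (1 - t)" and "Q = 2 - t + 2 * \<alpha> * (1 - t)"
  have P: "P \<ge> 1 - \<alpha>" and Q: "Q \<ge> 1"
    using gain_denominators[OF \<alpha> t] by (simp_all add: P_def Q_def)
  define N where "N = 2 * (1 - \<alpha>) * (1 + \<alpha> * (1 - t)) - P * Q"
  have N: "N = t * (1 - 3 * \<alpha> - 2 * \<alpha>\<^sup>2 + \<alpha> * t * (1 + 2 * \<alpha>))"
    unfolding N_def P_def Q_def by (simp add: algebra_simps power2_eq_square)
  have "\<alpha> * t * (1 + 2 * \<alpha>) \<le> 1 * 1 * 3"
    using \<alpha> t by (intro mult_mono) auto
  moreover have "0 \<le> \<alpha> * t * (1 + 2 * \<alpha>)" using \<alpha> t by auto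
  \<comment> \<open>A crude bound; dividing \<open>12\<close> by the \<open>2\<close> in the
    denominator yields the constant \<open>6\<close>.\<close>
  ultimately have "\<bar>1 - 3 * \<alpha> - 2 * \<alpha>\<^sup>2 + \<alpha> * t * (1 + 2 * \<alpha>)\<bar> \<le> 12"
    using \<alpha> power_le_one[of \<alpha> 2] zero_le_power2[of \<alpha>] by linarith
  then have "\<bar>N\<bar> \<le> t * 12" unfolding N using t by (simp add: abs_mult)
  also have "\<dots> \<le> sqrt t * 12" using le_sqrt_unit t by simp
  finally have N12: "\<bar>N\<bar> \<le> sqrt t * 12" .
  have "t * snag_gain \<alpha> t - 1 / (2 * (1 - \<alpha>)) = (1 + \<alpha> * (1 - t)) / (P * Q) - 1 / (2 * (1 - \<alpha>))"
    using t by (simp add: snag_gain_def P_def Q_def mult_ac)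
  also have "\<dots> = N / (2 * (1 - \<alpha>) * (P * Q))"
    unfolding N_def using P Q \<alpha> by (simp add: divide_simps)
  finally have "\<bar>t * snag_gain \<alpha> t - 1 / (2 * (1 - \<alpha>))\<bar> = \<bar>N\<bar> / (2 * (1 - \<alpha>) * (P * Q))"
    using P Q \<alpha> by (simp add: abs_mult)
  also have "\<dots> \<le> (sqrt t * 12) / (2 * (1 - \<alpha>) * (1 - \<alpha>))"
    using N12 P Q \<alpha> t mult_mono[of "1 - \<alpha>" P 1 Q] by (intro frac_le mult_left_mono) auto
  also have "\<dots> = 6 / (1 - \<alpha>)\<^sup>2 * sqrt t"
  proof -
    have "(y * 12) / (2 * x * x) = 6 / x\<^sup>2 * y" for x y :: real
      by (simp add: power2_eq_square)
    then show ?thesis .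
  qed
  finally show ?thesis .
qed

text \<open>The same closed form for the sum of \<open>h n ^ 2\<close>, now with
  \<open>a = 1 + \<alpha> - t\<close> and \<open>c = \<alpha>\<close>.\<close>

definition sgdm_gain :: "real \<Rightarrow> real \<Rightarrow> real" where
  "sgdm_gain \<alpha> t = (1 + \<alpha>) / ((1 - \<alpha>) * t * (2 + 2 * \<alpha> - t))"

text \<open>The error is exactly \<open>t / (2 * (1 - \<alpha>) * (2 + 2 * \<alpha> - t))\<close>.
  It is bounded generously so that one constant serves both methods.\<close>

lemma sgdm_gain_near_0:
  assumes \<alpha>: "0 \<le> \<alpha>" "\<alpha> < 1" and t: "0 < t" "t \<le> 1"
  shows "\<bar>t * sgdm_gain \<alpha> t - 1 / (2 * (1 - \<alpha>))\<bar> \<le> 6 / (1 - \<alpha>)\<^sup>2 * sqrt t"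
proof -
  define E where "E = 2 + 2 * \<alpha> - t"
  have "E > 0" using \<alpha> t by (simp add: E_def algebra_simps)
  then have "(1 + \<alpha>) / ((1 - \<alpha>) * E) - 1 / (2 * (1 - \<alpha>)) = t / (2 * (1 - \<alpha>) * E)"
    using \<alpha> by (simp add: divide_simps) (simp add: E_def algebra_simps)
  then have "t * sgdm_gain \<alpha> t - 1 / (2 * (1 - \<alpha>)) = t / (2 * (1 - \<alpha>) * (2 + 2 * \<alpha> - t))"
    using t by (simp add: sgdm_gain_def E_def mult_ac)
  then have "\<bar>t * sgdm_gain \<alpha> t - 1 / (2 * (1 - \<alpha>))\<bar> = t / (2 * (1 - \<alpha>) * (2 + 2 * \<alpha> - t))"
    using \<alpha> t by (simp add: abs_mult)
  also have "\<dots> \<le> (sqrt t * 12) / (2 * (1 - \<alpha>) * (1 - \<alpha>))"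
    using \<alpha> t le_sqrt_unit[of t] by (intro frac_le mult_left_mono) auto
  also have "\<dots> = 6 / (1 - \<alpha>)\<^sup>2 * sqrt t"
  proof -
    have "(y * 12) / (2 * x * x) = 6 / x\<^sup>2 * y" for x y :: real
      by (simp add: power2_eq_square)
    then show ?thesis .
  qed
  finally show ?thesis .
qed

text \<open>Pull out the factor \<open>\<gamma> * \<sigma> / l\<close> and use that
  \<open>\<gamma> / l * sqrt (\<gamma> * l)\<close> is \<open>sqrt (\<gamma> ^ 3 / l)\<close>; this
  is the origin of the remainder in the theorem.\<close>

lemma scaled_gain_error:
  assumes "\<gamma> > 0" "l > 0" "\<sigma> \<ge> 0"
    and "\<bar>\<gamma> * l * G - K\<bar> \<le> C * sqrt (\<gamma> * l)"
  shows "\<bar>\<gamma>\<^sup>2 * (\<sigma> * G) - \<gamma> * \<sigma> / l * K\<bar> \<le> C * \<sigma> * sqrt (\<gamma> ^ 3 / l)"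
proof -
  have "\<gamma>\<^sup>2 * (\<sigma> * G) - \<gamma> * \<sigma> / l * K = \<gamma> * \<sigma> / l * (\<gamma> * l * G - K)"
    using assms by (simp add: field_simps power2_eq_square)
  then have "\<bar>\<gamma>\<^sup>2 * (\<sigma> * G) - \<gamma> * \<sigma> / l * K\<bar> = \<gamma> * \<sigma> / l * \<bar>\<gamma> * l * G - K\<bar>"
    using assms by (simp add: abs_mult)
  also have "\<dots> \<le> \<gamma> * \<sigma> / l * (C * sqrt (\<gamma> * l))"
    using assms by (intro mult_left_mono) auto
  also have "\<gamma> / l * sqrt (\<gamma> * l) = sqrt (\<gamma> ^ 3 / l)"
  proof (rule real_sqrt_unique[symmetric])
    show "(\<gamma> / l * sqrt (\<gamma> * l))\<^sup>2 = \<gamma> ^ 3 / l"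
      unfolding power_mult_distrib using assms
      by (simp add: power_divide power2_eq_square[of l] power2_eq_square[of \<gamma>] power3_eq_cube)
  qed (use assms in auto)
  then have "\<gamma> * \<sigma> / l * (C * sqrt (\<gamma> * l)) = C * \<sigma> * sqrt (\<gamma> ^ 3 / l)"
    by (metis (no_types, opaque_lifting) mult.assoc mult.commute times_divide_eq_left)
  finally show ?thesis .
qed

section \<open>Variance of the stationary iterates\<close>

text \<open>The coordinates may be correlated, but the trace of \<open>outer (u i) (u j)\<close> is
  \<open>u i \<bullet> u j\<close>, so mixed moments drop out. Boundedness supplies
  integrability.\<close>

lemma trace_variance_orthogonal_sum:
  fixes u :: "'d::finite \<Rightarrow> real ^ 'd" and w :: "'d \<Rightarrow> 'w \<Rightarrow> real"
  assumes "prob_space M" and orth: "\<And>i j. u i \<bullet> u j = (if i = j then 1 else 0)"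
    and w: "\<And>i. w i \<in> borel_measurable M" "\<And>i. \<exists>K. \<forall>\<omega>. \<bar>w i \<omega>\<bar> \<le> K"
    and mean: "\<And>i. (\<integral>\<omega>. w i \<omega> \<partial>M) = 0"
  shows "trace (variance_matrix M (\<lambda>\<omega>. c + (\<Sum>i\<in>UNIV. w i \<omega> *\<^sub>R u i))) =
    (\<Sum>i\<in>UNIV. \<integral>\<omega>. (w i \<omega>)\<^sup>2 \<partial>M)"
proof -
  interpret prob_space M by fact
  note [measurable] = w(1)
  from w(2) obtain K where K: "\<And>i \<omega>. \<bar>w i \<omega>\<bar> \<le> K i" by metis
  have int1: "integrable M (w i)" for i
    by (rule integrable_const_bound[where B = "K i"]) (auto simp: K)
  have int2: "integrable M (\<lambda>\<omega>. w i \<omega> * w j \<omega>)" for i j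
  proof (rule integrable_const_bound[where B = "K i * K j"])
    have "\<bar>w i \<omega>\<bar> * \<bar>w j \<omega>\<bar> \<le> K i * K j" for \<omega>
      by (intro mult_mono K order_trans[OF abs_ge_zero K[of i \<omega>]]) simp
    then show "AE \<omega> in M. norm (w i \<omega> * w j \<omega>) \<le> K i * K j" by (simp add: abs_mult)
  qed measurable
  let ?X = "\<lambda>\<omega>. c + (\<Sum>i\<in>UNIV. w i \<omega> *\<^sub>R u i)"
  have m: "(LINT \<omega>|M. ?X \<omega>) = c"
    by (simp add: int1 mean prob_space)
  have "outer (?X \<omega> - c) (?X \<omega> - c) =
      (\<Sum>i\<in>UNIV. \<Sum>j\<in>UNIV. (w i \<omega> * w j \<omega>) *\<^sub>R outer (u i) (u j))" for \<omega>
    by (simp add: vec_eq_iff outer_def sum_product mult_ac)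
  then have "variance_matrix M ?X =
      (\<Sum>i\<in>UNIV. \<Sum>j\<in>UNIV. (\<integral>\<omega>. w i \<omega> * w j \<omega> \<partial>M) *\<^sub>R outer (u i) (u j))"
    unfolding variance_matrix_def Let_def m by (simp add: int2)
  moreover have "trace (outer (u i) (u j)) = (if i = j then 1 else 0)" for i j
    using orth[of i j] by (simp add: trace_def outer_def inner_vec_def)
  moreover have "trace (\<Sum>i\<in>I. f i) = (\<Sum>i\<in>I. trace (f i))"
    for I :: "'d set" and f :: "'d \<Rightarrow> real ^ 'd ^ 'd"
    unfolding trace_def by (simp add: sum.swap[of _ I])
  moreover have "trace (r *\<^sub>R f) = r * trace f" for r and f :: "real ^ 'd ^ 'd"
    by (simp add: trace_def sum_distrib_left)
  ultimately show ?thesis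
    by (simp add: power2_eq_square if_distrib[where f = "\<lambda>y. _ * y"] cong: if_cong)
qed

text \<open>The expansion of \<open>T\<close> identifies the impulse response as a sum of rank-one
  matrices, so the coordinate of the iterate along \<open>u i\<close> is a centred series of
  independent samples with coefficients \<open>g i\<close>.\<close>

lemma trace_variance_stationary:
  fixes A :: "'n::finite \<Rightarrow> real ^ 'd ^ 'd"
  assumes M: "prob_space M" "iid_uniform M idx"
    and A: "strictly_posdef (avg A)" "orthonormal_eigenbasis (avg A) u lam"
    and g: "\<And>i. summable (\<lambda>n. \<bar>g i n\<bar>)"
    and T: "\<And>z. cmod z = 1 \<Longrightarrow>
      T z = spectral_matrix u (\<lambda>i. \<Sum>n. of_real (g i n) * z powi (- (int n + 1)))"
  shows "trace (variance_matrix M (stationary_iterate T A b idx k)) =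
    (\<Sum>i\<in>UNIV. (u i \<bullet> (noise_cov A b *v u i)) * (\<Sum>n. (g i n)\<^sup>2))"
proof -
  \<comment> \<open>Causal extension of \<open>g\<close> to all integers: entry \<open>n\<close>
    sits at lag \<open>n + 1\<close>, and lags below \<open>1\<close> get \<open>0\<close>.\<close>
  define G where "G i j = (if j \<ge> 1 then g i (nat (j - 1)) else 0)" for i and j :: int
  define H where "H j = (\<Sum>i\<in>UNIV. G i j *\<^sub>R outer (u i) (u i))" for j
  define y where "y = noise A b"
  \<comment> \<open>Lag \<open>n + 1\<close> seen from time \<open>k\<close> is the sample at time
    \<open>k - 1 - n\<close>.\<close>
  define w where "w i \<omega> = (\<Sum>n. g i n * (u i \<bullet> y (idx (k - 1 - int n) \<omega>)))" for i \<omega>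
  have G: "G i (int n + 1) = g i n" "G i (1 + int n) = g i n" for i n by (simp_all add: G_def)
  have "impulse_response T = H"
  proof (rule impulse_response_eqI, intro has_sum_vecI)
    fix z :: complex and p q assume z: "cmod z = 1"
    have "((\<lambda>k. of_real (G i k) * z powi (- k)) has_sum
        (\<Sum>n. of_real (g i n) * z powi (- (int n + 1)))) UNIV" for i
      using has_sum_range_nat[of "\<lambda>n. int n + 1" "\<lambda>k. of_real (G i k) * z powi (- k)"] g[of i] z
      by (force simp: inj_def G norm_mult norm_power_int G_def intro: range_eqI[of _ _ "nat (_ - 1)"])
    then have "((\<lambda>k. \<Sum>i\<in>UNIV. of_real (G i k) * z powi (- k) * of_real (u i $ p * u i $ q)) has_sum
        (\<Sum>i\<in>UNIV. (\<Sum>n. of_real (g i n) * z powi (- (int n + 1))) * of_real (u i $ p * u i $ q))) UNIV"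
      by (intro has_sum_sum has_sum_cmult_left)
    then show "((\<lambda>k. (mat (z powi (- k)) ** cmat (H k)) $ p $ q) has_sum (T z $ p $ q)) UNIV"
      by (simp add: T[OF z] spectral_matrix_def mat_mult_nth cmat_def H_def outer_def sum_distrib_left mult_ac)
  qed
  moreover have "(\<Sum>\<^sub>\<infinity>j\<in>UNIV. H (k - j) *v y (idx j \<omega>)) = (\<Sum>i\<in>UNIV. w i \<omega> *\<^sub>R u i)" for \<omega>
  proof (rule infsumI)
    have H_mult: "H (k - j) *v x = (\<Sum>i\<in>UNIV. (G i (k - j) * (u i \<bullet> x)) *\<^sub>R u i)" for j x
      by (simp add: H_def matrix_vector_mult_sum_left scaleR_matrix_vector_assoc[symmetric]
          outer_mult_vec)
    have "((\<lambda>j. G i (k - j) * (u i \<bullet> y (idx j \<omega>))) has_sum w i \<omega>) UNIV" for i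
    proof -
      have "j \<in> range (\<lambda>n. k - 1 - int n)" if "G i (k - j) \<noteq> 0" for j
        using that by (intro range_eqI[of _ _ "nat (k - j - 1)"]) (auto simp: G_def split: if_splits)
      moreover have "summable (\<lambda>n. \<bar>g i n * (u i \<bullet> y (idx (k - 1 - int n) \<omega>))\<bar>)"
        by (rule summable_mult_finite_range[OF g, where f = "\<lambda>x. u i \<bullet> y x"])
      ultimately show ?thesis
        using has_sum_range_nat[of "\<lambda>n. k - 1 - int n" "\<lambda>j. G i (k - j) * (u i \<bullet> y (idx j \<omega>))"]
        by (force simp: inj_def G w_def)
    qed
    then show "((\<lambda>j. H (k - j) *v y (idx j \<omega>)) has_sum (\<Sum>i\<in>UNIV. w i \<omega> *\<^sub>R u i)) UNIV"
      unfolding H_mult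
      by (intro has_sum_sum has_sum_bounded_linear[where h = "\<lambda>r. r *\<^sub>R _", OF bounded_linear_scaleR_left])
  qed
  ultimately have X: "stationary_iterate T A b idx k =
      (\<lambda>\<omega>. minimizer A b + (\<Sum>i\<in>UNIV. w i \<omega> *\<^sub>R u i))"
    by (simp add: stationary_iterate_def fun_eq_iff y_def)
  have "(\<Sum>i\<in>UNIV. y i) = 0"
    using avg_noise[OF A(1), of b] by (simp add: avg_def y_def)
  then have y0: "(\<Sum>x\<in>UNIV. u i \<bullet> y x) = 0" for i
    by (simp flip: inner_sum_right)
  have e: "inj (\<lambda>n. k - 1 - int n)" by (simp add: inj_def)
  have w: "w i \<in> borel_measurable M" "\<exists>K. \<forall>\<omega>. \<bar>w i \<omega>\<bar> \<le> K" "(\<integral>\<omega>. w i \<omega> \<partial>M) = 0"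
    and w2: "(\<integral>\<omega>. (w i \<omega>)\<^sup>2 \<partial>M) =
      (\<Sum>n. (g i n)\<^sup>2) * ((\<Sum>x\<in>UNIV. (u i \<bullet> y x)\<^sup>2) / real CARD('n))" for i
    unfolding w_def[abs_def] by (rule iid_series_moments[OF M y0 g e])+
  have orth: "u i \<bullet> u j = (if i = j then 1 else 0)" for i j
    using A(2) by (simp add: orthonormal_eigenbasis_def)
  show ?thesis
    using trace_variance_orthogonal_sum[where w = w and u = u, OF M(1) orth w, of "minimizer A b"]
    by (simp only: X w2 inner_noise_cov y_def mult.commute)
qed

text \<open>Common core of both methods, which differ only in the coefficients \<open>a\<close> and
  \<open>c\<close> of the characteristic polynomial. Its roots lie in \<open>[0, 1)\<close>, so it
  has no zero on the unit circle and \<open>T\<close> may be used there.\<close>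

lemma trace_variance_second_order:
  fixes A :: "'n::finite \<Rightarrow> real ^ 'd ^ 'd"
  assumes M: "prob_space M" "iid_uniform M idx"
    and A: "strictly_posdef (avg A)" "orthonormal_eigenbasis (avg A) u lam"
    and stable: "\<And>i. 0 \<le> a i" "\<And>i. 0 \<le> c i" "\<And>i. c i < 1" "\<And>i. a i < 1 + c i"
      "\<And>i. 4 * c i \<le> (a i)\<^sup>2"
    and T: "\<And>z. cmod z = 1 \<Longrightarrow> (\<And>i. z\<^sup>2 - z * of_real (a i) + of_real (c i) \<noteq> 0) \<Longrightarrow>
      T z = spectral_matrix u (\<lambda>i. - of_real \<gamma> * (z / (z\<^sup>2 - z * of_real (a i) + of_real (c i))))"
  shows "trace (variance_matrix M (stationary_iterate T A b idx k)) =
    (\<Sum>i\<in>UNIV. \<gamma>\<^sup>2 * ((u i \<bullet> (noise_cov A b *v u i)) *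
      ((1 + c i) / ((1 - c i) * ((1 + c i)\<^sup>2 - (a i)\<^sup>2)))))"
proof -
  have "\<exists>p q. 0 \<le> p \<and> p < 1 \<and> 0 \<le> q \<and> q < 1 \<and> p + q = a i \<and> p * q = c i" for i
    using stable_real_roots[of "a i" "c i"] stable by metis
  then obtain p q where pq: "\<And>i. 0 \<le> p i" "\<And>i. p i < 1" "\<And>i. 0 \<le> q i" "\<And>i. q i < 1"
    and ac: "\<And>i. p i + q i = a i" "\<And>i. p i * q i = c i"
    by metis
  have trace: "trace (variance_matrix M (stationary_iterate T A b idx k)) =
      (\<Sum>i\<in>UNIV. (u i \<bullet> (noise_cov A b *v u i)) * (\<Sum>n. (- \<gamma> * ar_kernel (p i) (q i) n)\<^sup>2))"
  proof (rule trace_variance_stationary[OF M A])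
    show "summable (\<lambda>n. \<bar>- \<gamma> * ar_kernel (p i) (q i) n\<bar>)" for i
      using summable_mult[OF summable_ar_kernel[of "p i" "q i"], of "\<bar>\<gamma>\<bar>"] pq by (simp add: abs_mult)
  next
    fix z :: complex assume z: "cmod z = 1"
    have "z - of_real r \<noteq> 0" if "0 \<le> r" "r < 1" for r
      using that z by auto
    then have "(z - of_real (p i)) * (z - of_real (q i)) \<noteq> 0" for i
      using pq by simp
    moreover have "(z - of_real (p i)) * (z - of_real (q i)) = z\<^sup>2 - z * of_real (a i) + of_real (c i)" for i
      by (simp add: power2_eq_square algebra_simps flip: ac)
    ultimately have Tz: "T z = spectral_matrix u (\<lambda>i. - of_real \<gamma> * (z / (z\<^sup>2 - z * of_real (a i) + of_real (c i))))"
      using T[OF z] by simp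
    have "- of_real \<gamma> * (z / (z\<^sup>2 - z * of_real (a i) + of_real (c i))) =
        (\<Sum>n. of_real (- \<gamma> * ar_kernel (p i) (q i) n) * z powi (- (int n + 1)))" for i
      using sums_mult[OF ar_kernel_sums[OF pq(1-4) z, of i i], of "- of_real \<gamma>"]
      by (simp add: ac sums_iff mult.assoc)
    then show "T z =
      spectral_matrix u (\<lambda>i. \<Sum>n. of_real (- \<gamma> * ar_kernel (p i) (q i) n) * z powi (- (int n + 1)))"
      by (simp only: Tz)
  qed
  have "(\<Sum>n. (- \<gamma> * ar_kernel (p i) (q i) n)\<^sup>2) =
      \<gamma>\<^sup>2 * ((1 + c i) / ((1 - c i) * ((1 + c i)\<^sup>2 - (a i)\<^sup>2)))" for i
    using suminf_ar_kernel_square[OF pq(1-4), of i i]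
    by (simp add: power_mult_distrib suminf_mult ac)
  then show ?thesis unfolding trace by (simp only: mult.left_commute)
qed

section \<open>SNAG and SGDM as instances\<close>

lemma trace_variance_snag:
  fixes A :: "'n::finite \<Rightarrow> real ^ 'd ^ 'd"
  assumes M: "prob_space M" "iid_uniform M idx"
    and A: "strictly_posdef (avg A)" "orthonormal_eigenbasis (avg A) u lam"
    and \<alpha>: "0 \<le> \<alpha>" "\<alpha> < 1" and \<gamma>: "\<gamma> > 0"
    and step: "\<And>i. \<gamma> * lam i \<le> ((1 - \<alpha>) / (1 + \<alpha>))\<^sup>2"
  shows "trace (variance_matrix M (snag_iterate \<gamma> \<alpha> A b idx k)) =
    (\<Sum>i\<in>UNIV. \<gamma>\<^sup>2 * ((u i \<bullet> (noise_cov A b *v u i)) * snag_gain \<alpha> (\<gamma> * lam i)))"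
proof -
  have t: "0 < \<gamma> * lam i" for i using \<gamma> eigenvalue_pos[OF A(2,1)] by simp
  note adm = admissible_step[OF \<alpha> step]
  have c0: "0 \<le> \<alpha> * (1 - \<gamma> * lam i)" for i using \<alpha> adm(2)[of i] by simp
  have c1: "\<alpha> * (1 - \<gamma> * lam i) \<le> \<alpha> * 1" for i
    using t[of i] \<alpha> by (intro mult_left_mono) auto
  have "trace (variance_matrix M (stationary_iterate (snag_transfer \<gamma> \<alpha> (avg A)) A b idx k)) =
    (\<Sum>i\<in>UNIV. \<gamma>\<^sup>2 * ((u i \<bullet> (noise_cov A b *v u i)) *
      ((1 + \<alpha> * (1 - \<gamma> * lam i)) / ((1 - \<alpha> * (1 - \<gamma> * lam i)) *
        ((1 + \<alpha> * (1 - \<gamma> * lam i))\<^sup>2 - ((1 + \<alpha>) * (1 - \<gamma> * lam i))\<^sup>2)))))"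
  proof (rule trace_variance_second_order[OF M A])
    fix i
    show "0 \<le> (1 + \<alpha>) * (1 - \<gamma> * lam i)" using \<alpha> adm(2)[of i] by simp
    show "0 \<le> \<alpha> * (1 - \<gamma> * lam i)" by (rule c0)
    show "\<alpha> * (1 - \<gamma> * lam i) < 1" using c1[of i] \<alpha> by simp
    show "(1 + \<alpha>) * (1 - \<gamma> * lam i) < 1 + \<alpha> * (1 - \<gamma> * lam i)"
      using t[of i] by (simp add: algebra_simps)
    \<comment> \<open>This product, \<open>snag_disc\<close>, is the discriminant
      \<open>a^2 - 4 * c\<close>.\<close>
    have "0 \<le> (1 - \<gamma> * lam i) * ((1 - \<alpha>)\<^sup>2 - \<gamma> * lam i * (1 + \<alpha>)\<^sup>2)"
      using adm[of i] by (intro mult_nonneg_nonneg) auto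
    then show "4 * (\<alpha> * (1 - \<gamma> * lam i)) \<le> ((1 + \<alpha>) * (1 - \<gamma> * lam i))\<^sup>2"
      by (simp add: power2_eq_square algebra_simps)
  qed (rule snag_transfer_spectral[OF A(2)])
  moreover have "(1 + \<alpha> * (1 - x))\<^sup>2 - ((1 + \<alpha>) * (1 - x))\<^sup>2 = x * (2 - x + 2 * \<alpha> * (1 - x))" for x
    by (simp add: power2_eq_square algebra_simps)
  ultimately show ?thesis
    by (simp add: snag_iterate_def snag_gain_def mult.assoc)
qed

lemma trace_variance_sgdm:
  fixes A :: "'n::finite \<Rightarrow> real ^ 'd ^ 'd"
  assumes M: "prob_space M" "iid_uniform M idx"
    and A: "strictly_posdef (avg A)" "orthonormal_eigenbasis (avg A) u lam"
    and \<alpha>: "0 \<le> \<alpha>" "\<alpha> < 1" and \<gamma>: "\<gamma> > 0"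
    and step: "\<And>i. \<gamma> * lam i \<le> (1 - \<alpha>)\<^sup>2 / 4"
  shows "trace (variance_matrix M (sgdm_iterate \<gamma> \<alpha> A b idx k)) =
    (\<Sum>i\<in>UNIV. \<gamma>\<^sup>2 * ((u i \<bullet> (noise_cov A b *v u i)) * sgdm_gain \<alpha> (\<gamma> * lam i)))"
proof -
  have t: "0 < \<gamma> * lam i" for i using \<gamma> eigenvalue_pos[OF A(2,1)] by simp
  have t1: "\<gamma> * lam i \<le> 1" for i
    using step[of i] power_le_one[of "1 - \<alpha>" 2] \<alpha> by simp
  have "trace (variance_matrix M (stationary_iterate (sgdm_transfer \<gamma> \<alpha> (avg A)) A b idx k)) =
    (\<Sum>i\<in>UNIV. \<gamma>\<^sup>2 * ((u i \<bullet> (noise_cov A b *v u i)) *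
      ((1 + \<alpha>) / ((1 - \<alpha>) * ((1 + \<alpha>)\<^sup>2 - (1 + \<alpha> - \<gamma> * lam i)\<^sup>2)))))"
  proof (rule trace_variance_second_order[OF M A])
    fix i
    show "0 \<le> 1 + \<alpha> - \<gamma> * lam i" using t1[of i] \<alpha> by simp
    show "1 + \<alpha> - \<gamma> * lam i < 1 + \<alpha>" using t[of i] by simp
    \<comment> \<open>With \<open>t = \<gamma> * lam i\<close> the discriminant is
      \<open>(1 - \<alpha>)^2 - 2 * t * (1 + \<alpha>) + t^2\<close>; bounding
      \<open>1 + \<alpha>\<close> by \<open>2\<close> reduces its sign to the step
      condition.\<close>
    have "2 * (\<gamma> * lam i) * (1 + \<alpha>) \<le> 2 * (\<gamma> * lam i) * 2"
      using t[of i] \<alpha> by (intro mult_left_mono) auto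
    also have "\<dots> \<le> (1 - \<alpha>)\<^sup>2 + (\<gamma> * lam i)\<^sup>2" using step[of i] zero_le_power2[of "\<gamma> * lam i"] by linarith
    finally show "4 * \<alpha> \<le> (1 + \<alpha> - \<gamma> * lam i)\<^sup>2"
      by (simp add: power2_eq_square algebra_simps)
  qed (rule \<alpha> sgdm_transfer_spectral[OF A(2)])+
  moreover have "(1 + \<alpha>)\<^sup>2 - (1 + \<alpha> - x)\<^sup>2 = x * (2 + 2 * \<alpha> - x)" for x
    by (simp add: power2_eq_square algebra_simps)
  ultimately show ?thesis
    by (simp add: sgdm_iterate_def sgdm_gain_def mult.assoc)
qed

text \<open>Each remainder is taken to be the exact difference, so only its size has to be
  estimated; \<open>G\<close> stands for either gain.\<close>

lemma small_noise_expansion: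
  fixes \<sigma> lam :: "'d::finite \<Rightarrow> real"
  assumes "\<gamma> > 0" "\<And>i. lam i > 0" "\<And>i. \<sigma> i \<ge> 0" "\<And>i. \<gamma> * lam i \<le> 1"
    and "\<And>t. 0 < t \<Longrightarrow> t \<le> 1 \<Longrightarrow> \<bar>t * G t - 1 / (2 * (1 - \<alpha>))\<bar> \<le> C * sqrt t"
    and "V = (\<Sum>i\<in>UNIV. \<gamma>\<^sup>2 * (\<sigma> i * G (\<gamma> * lam i)))"
  shows "\<exists>R :: 'd \<Rightarrow> real. (\<forall>i. \<bar>R i\<bar> \<le> C * \<sigma> i * sqrt (\<gamma> ^ 3 / lam i)) \<and>
    V = (\<Sum>i\<in>UNIV. \<gamma> * \<sigma> i / (2 * (1 - \<alpha>) * lam i) + R i)"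
proof (intro exI conjI allI)
  let ?R = "\<lambda>i. \<gamma>\<^sup>2 * (\<sigma> i * G (\<gamma> * lam i)) - \<gamma> * \<sigma> i / lam i * (1 / (2 * (1 - \<alpha>)))"
  show "\<bar>?R i\<bar> \<le> C * \<sigma> i * sqrt (\<gamma> ^ 3 / lam i)" for i
    by (rule scaled_gain_error) (use assms in auto)
  show "V = (\<Sum>i\<in>UNIV. \<gamma> * \<sigma> i / (2 * (1 - \<alpha>) * lam i) + ?R i)"
    by (simp add: assms(6) mult.commute mult.left_commute)
qed

text \<open>The limit is encoded by constants chosen before the problem data, so the remainder is
  uniform in them for fixed \<alpha>; treating both iterates with the same leading term expresses
  the agreement with SGDM.\<close>

theorem corollary1:
  fixes M :: "'w measure" and idx :: "int \<Rightarrow> 'w \<Rightarrow> 'n::finite" and \<alpha> :: real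
  assumes "prob_space M" and "iid_uniform M idx" and "0 \<le> \<alpha>" and "\<alpha> < 1"
  shows
    "(\<forall>(A :: 'n \<Rightarrow> real ^ 'd ^ 'd) b u lam \<gamma> k.
        symmetric_family A \<longrightarrow> strictly_posdef (avg A) \<longrightarrow> orthonormal_eigenbasis (avg A) u lam \<longrightarrow>
        \<gamma> > 0 \<longrightarrow> (\<forall>i. ((1 - \<alpha>) / (1 + \<alpha>))\<^sup>2 \<ge> \<gamma> * lam i) \<longrightarrow>
        trace (variance_matrix M (snag_iterate \<gamma> \<alpha> A b idx k)) =
          \<gamma>\<^sup>2 * (\<Sum>i\<in>UNIV. (u i \<bullet> (noise_cov A b *v u i)) * snag_coeff \<gamma> \<alpha> (lam i)))
     \<and>
     (\<exists>C > 0. \<exists>\<delta> > 0. \<forall>(A :: 'n \<Rightarrow> real ^ 'd ^ 'd) b u lam \<gamma> k.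
        symmetric_family A \<longrightarrow> strictly_posdef (avg A) \<longrightarrow> orthonormal_eigenbasis (avg A) u lam \<longrightarrow>
        \<gamma> > 0 \<longrightarrow> (\<forall>i. \<gamma> * lam i \<le> \<delta> * (1 - \<alpha>)) \<longrightarrow>
        (\<forall>x \<in> {snag_iterate \<gamma> \<alpha> A b idx k, sgdm_iterate \<gamma> \<alpha> A b idx k}.
           \<exists>R :: 'd \<Rightarrow> real.
             (\<forall>i. \<bar>R i\<bar> \<le> C * (u i \<bullet> (noise_cov A b *v u i)) * sqrt (\<gamma> ^ 3 / lam i)) \<and>
             trace (variance_matrix M x) =
               (\<Sum>i\<in>UNIV. \<gamma> * (u i \<bullet> (noise_cov A b *v u i)) / (2 * (1 - \<alpha>) * lam i) + R i)))"
proof (rule conjI)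
  note M = assms(1,2) and \<alpha> = assms(3,4)
  show "\<forall>(A :: 'n \<Rightarrow> real ^ 'd ^ 'd) b u lam \<gamma> k.
        symmetric_family A \<longrightarrow> strictly_posdef (avg A) \<longrightarrow> orthonormal_eigenbasis (avg A) u lam \<longrightarrow>
        \<gamma> > 0 \<longrightarrow> (\<forall>i. ((1 - \<alpha>) / (1 + \<alpha>))\<^sup>2 \<ge> \<gamma> * lam i) \<longrightarrow>
        trace (variance_matrix M (snag_iterate \<gamma> \<alpha> A b idx k)) =
          \<gamma>\<^sup>2 * (\<Sum>i\<in>UNIV. (u i \<bullet> (noise_cov A b *v u i)) * snag_coeff \<gamma> \<alpha> (lam i))"
  proof (intro allI impI)
    fix A :: "'n \<Rightarrow> real ^ 'd ^ 'd" and b u lam \<gamma> k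
    assume A: "strictly_posdef (avg A)" "orthonormal_eigenbasis (avg A) u lam"
      and \<gamma>: "\<gamma> > 0" and step: "\<forall>i. ((1 - \<alpha>) / (1 + \<alpha>))\<^sup>2 \<ge> \<gamma> * lam i"
    have "snag_coeff \<gamma> \<alpha> (lam i) = snag_gain \<alpha> (\<gamma> * lam i)" for i
      using snag_coeff_eq[OF \<gamma> eigenvalue_pos[OF A(2,1)] \<alpha>] step by blast
    then show "trace (variance_matrix M (snag_iterate \<gamma> \<alpha> A b idx k)) =
        \<gamma>\<^sup>2 * (\<Sum>i\<in>UNIV. (u i \<bullet> (noise_cov A b *v u i)) * snag_coeff \<gamma> \<alpha> (lam i))"
      using trace_variance_snag[OF M A \<alpha> \<gamma>] step by (simp add: sum_distrib_left)
  qed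
  \<comment> \<open>With \<open>\<delta> = (1 - \<alpha>) / 4\<close> the step is admissible for SNAG, and SGDM too has real roots.\<close>
  have near: "t \<le> ((1 - \<alpha>) / (1 + \<alpha>))\<^sup>2" "t \<le> (1 - \<alpha>)\<^sup>2 / 4" "t \<le> 1"
    if "t \<le> (1 - \<alpha>) / 4 * (1 - \<alpha>)" for t
  proof -
    show t: "t \<le> (1 - \<alpha>)\<^sup>2 / 4" using that by (simp add: power2_eq_square)
    also have "\<dots> = ((1 - \<alpha>) / 2)\<^sup>2" by (simp add: power_divide)
    also have "\<dots> \<le> ((1 - \<alpha>) / (1 + \<alpha>))\<^sup>2"
      using \<alpha> by (intro power_mono divide_left_mono) auto
    finally show "t \<le> ((1 - \<alpha>) / (1 + \<alpha>))\<^sup>2" .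
    show "t \<le> 1" using t power_le_one[of "1 - \<alpha>" 2] \<alpha> by simp
  qed
  have "\<forall>(A :: 'n \<Rightarrow> real ^ 'd ^ 'd) b u lam \<gamma> k.
        symmetric_family A \<longrightarrow> strictly_posdef (avg A) \<longrightarrow> orthonormal_eigenbasis (avg A) u lam \<longrightarrow>
        \<gamma> > 0 \<longrightarrow> (\<forall>i. \<gamma> * lam i \<le> (1 - \<alpha>) / 4 * (1 - \<alpha>)) \<longrightarrow>
        (\<forall>x \<in> {snag_iterate \<gamma> \<alpha> A b idx k, sgdm_iterate \<gamma> \<alpha> A b idx k}.
           \<exists>R :: 'd \<Rightarrow> real.
             (\<forall>i. \<bar>R i\<bar> \<le> 6 / (1 - \<alpha>)\<^sup>2 * (u i \<bullet> (noise_cov A b *v u i)) * sqrt (\<gamma> ^ 3 / lam i)) \<and>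
             trace (variance_matrix M x) =
               (\<Sum>i\<in>UNIV. \<gamma> * (u i \<bullet> (noise_cov A b *v u i)) / (2 * (1 - \<alpha>) * lam i) + R i))"
  proof (intro allI impI ballI)
    fix A :: "'n \<Rightarrow> real ^ 'd ^ 'd" and b u lam \<gamma> k x
    assume A: "strictly_posdef (avg A)" "orthonormal_eigenbasis (avg A) u lam"
      and \<gamma>: "\<gamma> > 0" and step: "\<forall>i. \<gamma> * lam i \<le> (1 - \<alpha>) / 4 * (1 - \<alpha>)"
      and x: "x \<in> {snag_iterate \<gamma> \<alpha> A b idx k, sgdm_iterate \<gamma> \<alpha> A b idx k}"
    note near = near[OF step[rule_format]]
    have \<sigma>: "u i \<bullet> (noise_cov A b *v u i) \<ge> 0" for i
      by (simp add: inner_noise_cov sum_nonneg)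
    note expand = small_noise_expansion[OF \<gamma> eigenvalue_pos[OF A(2,1)] \<sigma> near(3)]
    show "\<exists>R :: 'd \<Rightarrow> real.
             (\<forall>i. \<bar>R i\<bar> \<le> 6 / (1 - \<alpha>)\<^sup>2 * (u i \<bullet> (noise_cov A b *v u i)) * sqrt (\<gamma> ^ 3 / lam i)) \<and>
             trace (variance_matrix M x) =
               (\<Sum>i\<in>UNIV. \<gamma> * (u i \<bullet> (noise_cov A b *v u i)) / (2 * (1 - \<alpha>) * lam i) + R i)"
    proof (cases "x = snag_iterate \<gamma> \<alpha> A b idx k")
      case True
      show ?thesis
        by (rule expand[OF snag_gain_near_0[OF \<alpha>]])
          (auto simp: True trace_variance_snag[OF M A \<alpha> \<gamma> near(1)])
    next
      case False
      with x have "x = sgdm_iterate \<gamma> \<alpha> A b idx k" by simp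
      then show ?thesis
        by (intro expand[OF sgdm_gain_near_0[OF \<alpha>]])
          (auto simp: trace_variance_sgdm[OF M A \<alpha> \<gamma> near(2)])
    qed
  qed
  moreover have "6 / (1 - \<alpha>)\<^sup>2 > 0" "(1 - \<alpha>) / 4 > 0" using \<alpha> by auto
  ultimately show "\<exists>C > 0. \<exists>\<delta> > 0. \<forall>(A :: 'n \<Rightarrow> real ^ 'd ^ 'd) b u lam \<gamma> k.
        symmetric_family A \<longrightarrow> strictly_posdef (avg A) \<longrightarrow> orthonormal_eigenbasis (avg A) u lam \<longrightarrow>
        \<gamma> > 0 \<longrightarrow> (\<forall>i. \<gamma> * lam i \<le> \<delta> * (1 - \<alpha>)) \<longrightarrow>
        (\<forall>x \<in> {snag_iterate \<gamma> \<alpha> A b idx k, sgdm_iterate \<gamma> \<alpha> A b idx k}.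
           \<exists>R :: 'd \<Rightarrow> real.
             (\<forall>i. \<bar>R i\<bar> \<le> C * (u i \<bullet> (noise_cov A b *v u i)) * sqrt (\<gamma> ^ 3 / lam i)) \<and>
             trace (variance_matrix M x) =
               (\<Sum>i\<in>UNIV. \<gamma> * (u i \<bullet> (noise_cov A b *v u i)) / (2 * (1 - \<alpha>) * lam i) + R i))"
    by blast
qed

end
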